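(* Let $(X,\sigma)$ be a symplectic space of arbitrary (finite or infinite) dimension, with resolvent algebra $\mathcal{R}=\mathcal{R}(X,\sigma)$. Let $n\geq1$ and, for $m=1,\dots,n$, let $f_m\in X\setminus\{0\}$, $\lambda_m\in\mathbb{R}\setminus\{0\}$, $\rho_m\in\mathrm{spec}(R(\lambda_m,f_m))$, and let $\mathcal{I}(\lambda_m,f_m;\rho_m)$ be the ideal of $\mathcal{R}$ generated by $R(\lambda_m,f_m)-\rho_m\,\mathbf{1}$. Then $$\bigcap_{m=1}^n\mathcal{I}(\lambda_m,f_m;\rho_m)=\Big[\mathcal{R}\ \prod_{m=1}^n\big(R(\lambda_m,f_m)-\rho_m\,\mathbf{1}\big)\ \mathcal{R}\Big]=\Big[\prod_{m=1}^n\big(R(\lambda_m,f_m)-\rho_m\,\mathbf{1}\big)\ \mathcal{R}\Big]=\Big[\mathcal{R}\ \prod_{m=1}^n\big(R(\lambda_m,f_m)-\rho_m\,\mathbf{1}\big)\Big],$$ where the order of the operators $R(\lambda_m,f_m)-\rho_m\,\mathbf{1}$ in the products is arbitrary.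
   Context: A symplectic space $(X,\sigma)$ is a real vector space $X$ with a nondegenerate symplectic (bilinear, antisymmetric) form $\sigma : X\times X\to\mathbb{R}$. Standing assumption: $(X,\sigma)$ admits a complex structure, i.e. a real linear map $J:X\to X$ with $J^2=-1$, $\sigma(Jf,Jg)=\sigma(f,g)$ and $\sigma(f,Jf)>0$ for $f\neq 0$ (automatic if $\dim X<\infty$). Resolvent algebra: let $\mathcal{R}_0$ be the universal unital *-algebra (over $\mathbb{C}$) generated by symbols $R(\lambda,f)$, $\lambda\in\mathbb{R}\setminus\{0\}$, $f\in X$, subject to the relations, for all $\lambda,\mu,\nu\in\mathbb{R}\setminus\{0\}$ and $f,g\in X$: (1) $R(\lambda,f)-R(\mu,f)=i(\mu-\lambda)R(\lambda,f)R(\mu,f)$; (2) $R(\lambda,f)^*=R(-\lambda,f)$; (3) $[R(\lambda,f),R(\mu,g)]=i\sigma(f,g)R(\lambda,f)R(\mu,g)^2R(\lambda,f)$ (here the bracket is the commutator); (4) $\nu R(\nu\lambda,\nu f)=R(\lambda,f)$; (5) $R(\lambda,f)R(\mu,g)=R(\lambda+\mu,f+g)\big(R(\lambda,f)+R(\mu,g)+i\sigma(f,g)R(\lambda,f)^2R(\mu,g)\big)$ if $\lambda+\mu\neq0$; (6) $R(\lambda,0)=-\frac{i}{\lambda}\mathbf{1}$. Let $\mathfrak{S}$ be the set of positive normalized functionals $\omega$ on $\mathcal{R}_0$, with GNS-representations $(\pi_\omega,\mathcal{H}_\omega)$ (these are uniformly bounded over $\mathfrak{S}$). Then $\|A\|=\sup_{\omega\in\mathfrak{S}}\|\pi_\omega(A)\|$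 is a C*-seminorm on $\mathcal{R}_0$, and $\mathcal{R}(X,\sigma)$ is the C*-completion of $\mathcal{R}_0/\ker\|\cdot\|$. "Ideal" always means closed two-sided ideal. In the claim, $[\,\cdot\,]$ denotes the closed linear span of its argument (e.g. $[\mathcal{R}A\mathcal{R}]$ is the closed linear span of $\{BAC:B,C\in\mathcal{R}\}$). $\mathrm{spec}(R(\lambda,f))$ is the spectrum of $R(\lambda,f)$ in $\mathcal{R}(X,\sigma)$. *)

theory Defs
  imports "HOL-Analysis.Analysis"
begin

section \<open>Symplectic spaces\<close>

text \<open>
  The carrier \<open>X\<close> is a type of class \<open>real_vector\<close> (no restriction on the dimension), and the
  symplectic form is a class parameter, so that the resolvent algebra of \<open>(X, \<sigma>)\<close> becomes a type
  constructor applied to \<open>X\<close>.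
\<close>

class symplectic_space = real_vector +
  fixes sform :: "'a \<Rightarrow> 'a \<Rightarrow> real"
  assumes sform_add_left: "sform (f + g) h = sform f h + sform g h"
    and sform_add_right: "sform f (g + h) = sform f g + sform f h"
    and sform_scaleR_left: "sform (r *\<^sub>R f) g = r * sform f g"
    and sform_scaleR_right: "sform f (r *\<^sub>R g) = r * sform f g"
    and sform_antisym: "sform f g = - sform g f"
    and sform_nondegenerate: "(\<And>g. sform f g = 0) \<Longrightarrow> f = 0"
    and sform_complex_structure:
      "\<exists>J::'a \<Rightarrow> 'a. (\<forall>f g. J (f + g) = J f + J g) \<and> (\<forall>r f. J (r *\<^sub>R f) = r *\<^sub>R J f)
         \<and> (\<forall>f. J (J f) = - f) \<and> (\<forall>f g. sform (J f) (J g) = sform f g)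
         \<and> (\<forall>f. f \<noteq> 0 \<longrightarrow> sform f (J f) > 0)"


section \<open>Complex *-algebras and C*-algebras\<close>

text \<open>The class \<open>real_algebra_1\<close> includes \<open>0 \<noteq> 1\<close>.\<close>

class complex_star_algebra = real_algebra_1 +
  fixes scaleC :: "complex \<Rightarrow> 'a \<Rightarrow> 'a"  (infixr \<open>*\<^sub>C\<close> 75)
    and star :: "'a \<Rightarrow> 'a"
  assumes scaleC_add_right: "c *\<^sub>C (x + y) = c *\<^sub>C x + c *\<^sub>C y"
    and scaleC_add_left: "(c + d) *\<^sub>C x = c *\<^sub>C x + d *\<^sub>C x"
    and scaleC_scaleC: "c *\<^sub>C d *\<^sub>C x = (c * d) *\<^sub>C x"
    and scaleC_one: "1 *\<^sub>C x = x"
    and scaleR_scaleC: "r *\<^sub>R x = complex_of_real r *\<^sub>C x"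
    and mult_scaleC_left: "(c *\<^sub>C x) * y = c *\<^sub>C (x * y)"
    and mult_scaleC_right: "x * (c *\<^sub>C y) = c *\<^sub>C (x * y)"
    and star_add: "star (x + y) = star x + star y"
    and star_scaleC: "star (c *\<^sub>C x) = cnj c *\<^sub>C star x"
    and star_mult: "star (x * y) = star y * star x"
    and star_star: "star (star x) = x"

global_interpretation complex_vector: vector_space "scaleC :: complex \<Rightarrow> 'a \<Rightarrow> 'a::complex_star_algebra"
  by standard (simp_all add: scaleC_add_right scaleC_add_left scaleC_scaleC scaleC_one)

class pre_cstar_algebra = complex_star_algebra + real_normed_algebra_1 +
  assumes norm_scaleC: "norm (c *\<^sub>C x) = cmod c * norm x"
    and cstar_identity: "norm (star x * x) = (norm x)\<^sup>2"

class cstar_algebra = pre_cstar_algebra + banach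

definition spectrum :: "'a::complex_star_algebra \<Rightarrow> complex set" where
  "spectrum a = {c. \<not> (\<exists>b. b * (a - c *\<^sub>C 1) = 1 \<and> (a - c *\<^sub>C 1) * b = 1)}"

definition closed_ideal :: "'a::cstar_algebra set \<Rightarrow> bool" where
  "closed_ideal I \<longleftrightarrow> closed I \<and> module.subspace scaleC I \<and> (\<forall>a\<in>I. \<forall>b. b * a \<in> I \<and> a * b \<in> I)"

definition ideal_generated :: "'a::cstar_algebra set \<Rightarrow> 'a set" where
  "ideal_generated S = closed_ideal hull S"

definition closed_cspan :: "'a::cstar_algebra set \<Rightarrow> 'a set" where
  "closed_cspan S = closure (module.span scaleC S)"


section \<open>The universal unital *-algebra generated by the resolvent symbols\<close>

text \<open>
  The algebra \<open>\<R>\<^sub>0\<close> is the algebra of formal *-polynomials in the generators \<open>R(\<lambda>, f)\<close> modulo the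
  least congruence containing the laws of a unital complex *-algebra and the defining relations.
  The symbols \<open>R(\<lambda>, f)\<close> exist only for \<open>\<lambda> \<noteq> 0\<close>; the superfluous generators with \<open>\<lambda> = 0\<close>
  that come from taking a real index are removed by identifying them with \<open>0\<close>.
\<close>

datatype 'x rterm =
    Gen real 'x
  | Zero
  | One
  | Add "'x rterm" "'x rterm"  (infixl \<open>\<oplus>\<close> 65)
  | Mul "'x rterm" "'x rterm"  (infixl \<open>\<otimes>\<close> 70)
  | Scale complex "'x rterm"  (infixr \<open>\<odot>\<close> 75)
  | Star "'x rterm"

abbreviation Sub :: "'x rterm \<Rightarrow> 'x rterm \<Rightarrow> 'x rterm"  (infixl \<open>\<ominus>\<close> 65) where
  "s \<ominus> t \<equiv> s \<oplus> (-1) \<odot> t"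

inductive resolvent_rel :: "'x::symplectic_space rterm \<Rightarrow> 'x rterm \<Rightarrow> bool"  (infix \<open>\<doteq>\<close> 50) where
  \<comment> \<open>congruence\<close>
  rel_refl: "s \<doteq> s"
| rel_sym: "s \<doteq> t \<Longrightarrow> t \<doteq> s"
| rel_trans: "s \<doteq> t \<Longrightarrow> t \<doteq> u \<Longrightarrow> s \<doteq> u"
| Add_cong: "s \<doteq> s' \<Longrightarrow> t \<doteq> t' \<Longrightarrow> s \<oplus> t \<doteq> s' \<oplus> t'"
| Mul_cong: "s \<doteq> s' \<Longrightarrow> t \<doteq> t' \<Longrightarrow> s \<otimes> t \<doteq> s' \<otimes> t'"
| Scale_cong: "s \<doteq> s' \<Longrightarrow> c \<odot> s \<doteq> c \<odot> s'"
| Star_cong: "s \<doteq> s' \<Longrightarrow> Star s \<doteq> Star s'"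
  \<comment> \<open>laws of a unital complex *-algebra\<close>
| Add_assoc: "(s \<oplus> t) \<oplus> u \<doteq> s \<oplus> (t \<oplus> u)"
| Add_commute: "s \<oplus> t \<doteq> t \<oplus> s"
| Add_Zero: "Zero \<oplus> s \<doteq> s"
| Add_inverse: "s \<ominus> s \<doteq> Zero"
| Mul_assoc: "(s \<otimes> t) \<otimes> u \<doteq> s \<otimes> (t \<otimes> u)"
| Mul_One_left: "One \<otimes> s \<doteq> s"
| Mul_One_right: "s \<otimes> One \<doteq> s"
| Mul_Add_left: "s \<otimes> (t \<oplus> u) \<doteq> s \<otimes> t \<oplus> s \<otimes> u"
| Mul_Add_right: "(s \<oplus> t) \<otimes> u \<doteq> s \<otimes> u \<oplus> t \<otimes> u"
| Scale_Add: "c \<odot> (s \<oplus> t) \<doteq> c \<odot> s \<oplus> c \<odot> t"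
| Scale_add: "(c + d) \<odot> s \<doteq> c \<odot> s \<oplus> d \<odot> s"
| Scale_Scale: "c \<odot> d \<odot> s \<doteq> (c * d) \<odot> s"
| Scale_one: "1 \<odot> s \<doteq> s"
| Mul_Scale_left: "(c \<odot> s) \<otimes> t \<doteq> c \<odot> (s \<otimes> t)"
| Mul_Scale_right: "s \<otimes> (c \<odot> t) \<doteq> c \<odot> (s \<otimes> t)"
| Star_Add: "Star (s \<oplus> t) \<doteq> Star s \<oplus> Star t"
| Star_Mul: "Star (s \<otimes> t) \<doteq> Star t \<otimes> Star s"
| Star_Scale: "Star (c \<odot> s) \<doteq> cnj c \<odot> Star s"
| Star_Star: "Star (Star s) \<doteq> s"
  \<comment> \<open>resolvent relations\<close>
| Gen_superfluous: "Gen 0 f \<doteq> Zero"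
| Gen_resolvent: "l \<noteq> 0 \<Longrightarrow> m \<noteq> 0 \<Longrightarrow>
    Gen l f \<ominus> Gen m f \<doteq> (\<i> * of_real (m - l)) \<odot> (Gen l f \<otimes> Gen m f)"
| Gen_star: "l \<noteq> 0 \<Longrightarrow> Star (Gen l f) \<doteq> Gen (- l) f"
| Gen_commutator: "l \<noteq> 0 \<Longrightarrow> m \<noteq> 0 \<Longrightarrow>
    Gen l f \<otimes> Gen m g \<ominus> Gen m g \<otimes> Gen l f \<doteq>
    (\<i> * of_real (sform f g)) \<odot> (Gen l f \<otimes> (Gen m g \<otimes> Gen m g) \<otimes> Gen l f)"
| Gen_scale: "l \<noteq> 0 \<Longrightarrow> n \<noteq> 0 \<Longrightarrow> of_real n \<odot> Gen (n * l) (n *\<^sub>R f) \<doteq> Gen l f"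
| Gen_add: "l \<noteq> 0 \<Longrightarrow> m \<noteq> 0 \<Longrightarrow> l + m \<noteq> 0 \<Longrightarrow>
    Gen l f \<otimes> Gen m g \<doteq> Gen (l + m) (f + g) \<otimes>
      (Gen l f \<oplus> Gen m g \<oplus> (\<i> * of_real (sform f g)) \<odot> ((Gen l f \<otimes> Gen l f) \<otimes> Gen m g))"
| Gen_zero: "l \<noteq> 0 \<Longrightarrow> Gen l 0 \<doteq> (- \<i> / of_real l) \<odot> One"

text \<open>
  The *-character with \<open>R(\<lambda>, f) \<mapsto> 0\<close> for \<open>f \<noteq> 0\<close>; it shows that \<open>\<R>\<^sub>0\<close> is not the zero
  algebra and that it has a state.
\<close>

primrec char0 :: "'x::zero rterm \<Rightarrow> complex" where
  "char0 (Gen l f) = (if f = 0 then - \<i> / of_real l else 0)"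
| "char0 Zero = 0"
| "char0 One = 1"
| "char0 (s \<oplus> t) = char0 s + char0 t"
| "char0 (s \<otimes> t) = char0 s * char0 t"
| "char0 (c \<odot> s) = c * char0 s"
| "char0 (Star s) = cnj (char0 s)"

lemma sform_zero [simp]: "sform 0 g = 0" "sform g 0 = 0"
  using sform_scaleR_left[of 0] sform_scaleR_right[of _ 0] by auto

lemma char0_rel: "s \<doteq> t \<Longrightarrow> char0 s = char0 t"
proof (induction rule: resolvent_rel.induct)
  case (Gen_add l m f g)
  have "complex_of_real l + complex_of_real m \<noteq> 0"
    using Gen_add(3) by (metis of_real_add of_real_eq_0_iff)
  then have "(- \<i> / of_real l) * (- \<i> / of_real m) =
      (- \<i> / (of_real l + of_real m)) * (- \<i> / of_real l + - \<i> / complex_of_real m)"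
    using Gen_add(1,2) by (simp add: divide_simps) (simp add: algebra_simps)
  then show ?case
    using Gen_add by auto
qed (auto simp: field_simps)

quotient_type (overloaded) 'x resolvent_alg0 = "'x::symplectic_space rterm" / resolvent_rel
  by (intro equivpI reflpI sympI transpI) (auto intro: resolvent_rel.intros)

instantiation resolvent_alg0 :: (symplectic_space) complex_star_algebra
begin

lift_definition zero_resolvent_alg0 :: "'a resolvent_alg0" is Zero .
lift_definition one_resolvent_alg0 :: "'a resolvent_alg0" is One .
lift_definition plus_resolvent_alg0 :: "'a resolvent_alg0 \<Rightarrow> 'a resolvent_alg0 \<Rightarrow> 'a resolvent_alg0"
  is Add by (rule resolvent_rel.Add_cong)
lift_definition times_resolvent_alg0 :: "'a resolvent_alg0 \<Rightarrow> 'a resolvent_alg0 \<Rightarrow> 'a resolvent_alg0"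
  is Mul by (rule resolvent_rel.Mul_cong)
lift_definition scaleC_resolvent_alg0 :: "complex \<Rightarrow> 'a resolvent_alg0 \<Rightarrow> 'a resolvent_alg0"
  is Scale by (rule resolvent_rel.Scale_cong)
lift_definition star_resolvent_alg0 :: "'a resolvent_alg0 \<Rightarrow> 'a resolvent_alg0"
  is Star by (rule resolvent_rel.Star_cong)
definition scaleR_resolvent_alg0 :: "real \<Rightarrow> 'a resolvent_alg0 \<Rightarrow> 'a resolvent_alg0"
  where "r *\<^sub>R x = complex_of_real r *\<^sub>C x" for x :: "'a resolvent_alg0"
definition uminus_resolvent_alg0 :: "'a resolvent_alg0 \<Rightarrow> 'a resolvent_alg0"
  where "- x = (-1) *\<^sub>C x" for x :: "'a resolvent_alg0"
definition minus_resolvent_alg0 :: "'a resolvent_alg0 \<Rightarrow> 'a resolvent_alg0 \<Rightarrow> 'a resolvent_alg0"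
  where "x - y = x + - y" for x :: "'a resolvent_alg0"

instance
proof
  fix x y z :: "'a resolvent_alg0" and c d :: complex and r q :: real
  show "x + y + z = x + (y + z)" by transfer (rule resolvent_rel.Add_assoc)
  show A: "x + y = y + x" for x y :: "'a resolvent_alg0" by transfer (rule resolvent_rel.Add_commute)
  show "0 + x = x" by transfer (rule resolvent_rel.Add_Zero)
  have *: "x + (-1) *\<^sub>C x = 0" for x :: "'a resolvent_alg0" by transfer (rule resolvent_rel.Add_inverse)
  show "- x + x = 0" using *[of x] A by (metis uminus_resolvent_alg0_def)
  show "x - y = x + - y" by (rule minus_resolvent_alg0_def)
  show "x * y * z = x * (y * z)" by transfer (rule resolvent_rel.Mul_assoc)
  show "1 * x = x" by transfer (rule resolvent_rel.Mul_One_left)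
  show "x * 1 = x" by transfer (rule resolvent_rel.Mul_One_right)
  show "(x + y) * z = x * z + y * z" by transfer (rule resolvent_rel.Mul_Add_right)
  show "x * (y + z) = x * y + x * z" by transfer (rule resolvent_rel.Mul_Add_left)
  show "(0::'a resolvent_alg0) \<noteq> 1" by transfer (use char0_rel in force)
  show C1: "c *\<^sub>C (x + y) = c *\<^sub>C x + c *\<^sub>C y" for c and x y :: "'a resolvent_alg0" by transfer (rule resolvent_rel.Scale_Add)
  show C2: "(c + d) *\<^sub>C x = c *\<^sub>C x + d *\<^sub>C x" for c d and x :: "'a resolvent_alg0" by transfer (rule resolvent_rel.Scale_add)
  show C3: "c *\<^sub>C d *\<^sub>C x = (c * d) *\<^sub>C x" for c d and x :: "'a resolvent_alg0" by transfer (rule resolvent_rel.Scale_Scale)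
  show C4: "1 *\<^sub>C x = x" for x :: "'a resolvent_alg0" by transfer (rule resolvent_rel.Scale_one)
  show "r *\<^sub>R x = complex_of_real r *\<^sub>C x" by (rule scaleR_resolvent_alg0_def)
  show C5: "(c *\<^sub>C x) * y = c *\<^sub>C (x * y)" for c by transfer (rule resolvent_rel.Mul_Scale_left)
  show C6: "x * (c *\<^sub>C y) = c *\<^sub>C (x * y)" for c by transfer (rule resolvent_rel.Mul_Scale_right)
  show "r *\<^sub>R (x + y) = r *\<^sub>R x + r *\<^sub>R y" "(r + q) *\<^sub>R x = r *\<^sub>R x + q *\<^sub>R x"
    "r *\<^sub>R q *\<^sub>R x = (r * q) *\<^sub>R x" "1 *\<^sub>R x = x" "r *\<^sub>R x * y = r *\<^sub>R (x * y)"
    "x * r *\<^sub>R y = r *\<^sub>R (x * y)"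
    by (simp_all add: scaleR_resolvent_alg0_def C1 C2 C3 C4 C5 C6)
  show "star (x + y) = star x + star y" by transfer (rule resolvent_rel.Star_Add)
  show "star (c *\<^sub>C x) = cnj c *\<^sub>C star x" by transfer (rule resolvent_rel.Star_Scale)
  show "star (x * y) = star y * star x" by transfer (rule resolvent_rel.Star_Mul)
  show "star (star x) = x" by transfer (rule resolvent_rel.Star_Star)
qed

end

lift_definition gen0 :: "real \<Rightarrow> 'x \<Rightarrow> 'x::symplectic_space resolvent_alg0" is Gen .


section \<open>States, GNS representations and the C*-seminorm\<close>

definition states :: "('a::complex_star_algebra \<Rightarrow> complex) set" where
  "states = {\<omega>. (\<forall>x y. \<omega> (x + y) = \<omega> x + \<omega> y) \<and> (\<forall>c x. \<omega> (c *\<^sub>C x) = c * \<omega> x)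
                \<and> (\<forall>x. \<omega> (star x * x) \<in> \<real>\<^sub>\<ge>\<^sub>0) \<and> \<omega> 1 = 1}"

text \<open>
  The GNS space of \<open>\<omega>\<close> is the completion of the pre-Hilbert space obtained from the algebra with
  \<open>\<langle>x, y\<rangle> = \<omega> (star x * y)\<close> by factoring out the null vectors, and \<open>\<pi>\<^sub>\<omega>(a)\<close> is the continuous
  extension of \<open>x \<mapsto> a * x\<close>.  Its operator norm is therefore the one below, computed as in
  \<open>onorm\<close> on the dense image of the algebra (null vectors contribute \<open>0 / 0 = 0\<close>).
\<close>

definition gns_vnorm :: "('a::complex_star_algebra \<Rightarrow> complex) \<Rightarrow> 'a \<Rightarrow> real" where
  "gns_vnorm \<omega> x = sqrt (Re (\<omega> (star x * x)))"

definition gns_norm :: "('a::complex_star_algebra \<Rightarrow> complex) \<Rightarrow> 'a \<Rightarrow> real" where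
  "gns_norm \<omega> a = (SUP x. gns_vnorm \<omega> (a * x) / gns_vnorm \<omega> x)"

definition max_norm :: "'a::complex_star_algebra \<Rightarrow> real" where
  "max_norm a = (SUP \<omega>\<in>states. gns_norm \<omega> a)"

lemma star_zero [simp]: "star (0::'a::complex_star_algebra) = 0"
  using star_scaleC[of 0 "0::'a"] by simp

lemma star_one [simp]: "star (1::'a::complex_star_algebra) = 1"
  by (metis mult.left_neutral mult.right_neutral star_mult star_star)

lemma gns_state_diff:
  assumes "\<omega> \<in> states"
  shows "\<omega> (x - y) = \<omega> x - \<omega> y"
proof -
  have "\<omega> (x - y + y) = \<omega> (x - y) + \<omega> y"
    using assms unfolding states_def by blast
  then show ?thesis by simp
qed

lemma gns_form_cnj:
  assumes "\<omega> \<in> states"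
  shows "\<omega> (star y * x) = cnj (\<omega> (star x * y))"
proof -
  have add: "\<omega> (u + v) = \<omega> u + \<omega> v" and sc: "\<omega> (c *\<^sub>C u) = c * \<omega> u" 
    and pos: "\<omega> (star u * u) \<in> \<real>\<^sub>\<ge>\<^sub>0" for u v c
    using assms by (auto simp: states_def)
  have im: "Im (\<omega> (star u * u)) = 0" for u
    using pos[of u] by (simp add: complex_nonneg_Reals_iff)
  have "\<omega> (star (x + y) * (x + y)) = \<omega> (star x * x) + \<omega> (star x * y) + \<omega> (star y * x) + \<omega> (star y * y)"
    by (simp add: star_add algebra_simps add)
  from arg_cong[OF this, of Im] have 1: "Im (\<omega> (star x * y)) + Im (\<omega> (star y * x)) = 0"
    by (simp add: im)
  have "\<omega> (star (x + \<i> *\<^sub>C y) * (x + \<i> *\<^sub>C y)) =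
      \<omega> (star x * x) + \<i> * \<omega> (star x * y) - \<i> * \<omega> (star y * x) + \<omega> (star y * y)"
    by (simp add: star_add star_scaleC mult_scaleC_left mult_scaleC_right algebra_simps add sc
        gns_state_diff[OF assms])
  from arg_cong[OF this, of Im] have 2: "Re (\<omega> (star x * y)) = Re (\<omega> (star y * x))"
    by (simp add: im)
  show ?thesis using 1 2 by (simp add: complex_eq_iff)
qed

lemma gns_state_zero:
  assumes "\<omega> \<in> states"
  shows "\<omega> 0 = 0"
proof -
  have "\<omega> (0 *\<^sub>C 0) = 0 * \<omega> 0"
    using assms unfolding states_def by blast
  then show ?thesis by simp
qed

lemma gns_vnorm_sq:
  assumes "\<omega> \<in> states"
  shows "\<omega> (star x * x) = of_real ((gns_vnorm \<omega> x)\<^sup>2)" "gns_vnorm \<omega> x \<ge> 0"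
proof -
  have "\<omega> (star x * x) \<in> \<real>\<^sub>\<ge>\<^sub>0"
    using assms by (auto simp: states_def)
  then show "\<omega> (star x * x) = of_real ((gns_vnorm \<omega> x)\<^sup>2)" "gns_vnorm \<omega> x \<ge> 0"
    by (auto simp: complex_nonneg_Reals_iff gns_vnorm_def complex_eq_iff)
qed

lemma gns_form_expand:
  assumes "\<omega> \<in> states"
  shows "(gns_vnorm \<omega> (x + c *\<^sub>C y))\<^sup>2 =
    (gns_vnorm \<omega> x)\<^sup>2 + 2 * Re (c * \<omega> (star x * y)) + (cmod c)\<^sup>2 * (gns_vnorm \<omega> y)\<^sup>2"
proof -
  have add: "\<omega> (u + v) = \<omega> u + \<omega> v" and sc: "\<omega> (c *\<^sub>C u) = c * \<omega> u" for u v c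
    using assms by (auto simp: states_def)
  have "\<omega> (star (x + c *\<^sub>C y) * (x + c *\<^sub>C y)) =
      \<omega> (star x * x) + c * \<omega> (star x * y) + cnj c * \<omega> (star y * x) + (c * cnj c) * \<omega> (star y * y)"
    by (simp add: star_add star_scaleC mult_scaleC_left mult_scaleC_right algebra_simps add sc)
  also have "cnj c * \<omega> (star y * x) = cnj (c * \<omega> (star x * y))"
    by (subst gns_form_cnj[OF assms]) simp
  also have "c * cnj c = of_real ((cmod c)\<^sup>2)"
    by (rule complex_norm_square[symmetric])
  finally have eq: "of_real ((gns_vnorm \<omega> (x + c *\<^sub>C y))\<^sup>2) =
      of_real ((gns_vnorm \<omega> x)\<^sup>2) + c * \<omega> (star x * y) + cnj (c * \<omega> (star x * y))
        + of_real ((cmod c)\<^sup>2) * complex_of_real ((gns_vnorm \<omega> y)\<^sup>2)"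
    unfolding gns_vnorm_sq(1)[OF assms] .
  have "Re (cnj z) = Re z" for z by simp
  with arg_cong[OF eq, of Re] show ?thesis
    by (simp only: plus_complex.sel Re_complex_of_real of_real_mult[symmetric]) 
qed

lemma gns_Cauchy_Schwarz:
  assumes "\<omega> \<in> states"
  shows "cmod (\<omega> (star x * y)) \<le> gns_vnorm \<omega> x * gns_vnorm \<omega> y"
proof -
  define s where "s = \<omega> (star x * y)"
  define p q where "p = gns_vnorm \<omega> x" and "q = gns_vnorm \<omega> y"
  have pq: "p \<ge> 0" "q \<ge> 0" using gns_vnorm_sq(2)[OF assms] by (auto simp: p_def q_def)
  have *: "0 \<le> p\<^sup>2 - 2 * t * (cmod s)\<^sup>2 + t\<^sup>2 * (cmod s)\<^sup>2 * q\<^sup>2" for t :: real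
  proof -
    have "0 \<le> (gns_vnorm \<omega> (x + (- of_real t * cnj s) *\<^sub>C y))\<^sup>2" by simp
    also have "\<dots> = p\<^sup>2 + 2 * Re ((- of_real t * cnj s) * s) + (cmod (- of_real t * cnj s))\<^sup>2 * q\<^sup>2"
      unfolding gns_form_expand[OF assms] by (simp add: s_def p_def q_def)
    also have "(- of_real t * cnj s) * s = of_real (- t * (cmod s)\<^sup>2)"
      using complex_norm_square[of s] by simp
    also have "cmod (- of_real t * cnj s) = \<bar>t\<bar> * cmod s"
      by (simp add: norm_mult)
    finally show ?thesis by (simp add: power_mult_distrib)
  qed
  show ?thesis
  proof (cases "q = 0")
    case True
    have "cmod s = 0"
    proof (rule ccontr)
      assume ne: "cmod s \<noteq> 0"
      have "0 \<le> p\<^sup>2 - 2 * ((p\<^sup>2 + 1) / (cmod s)\<^sup>2) * (cmod s)\<^sup>2"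
        using *[of "(p\<^sup>2 + 1) / (cmod s)\<^sup>2"] True by simp
      also have "\<dots> = - p\<^sup>2 - 2" using ne by simp
      also have "\<dots> < 0" using zero_le_power2[of p] by linarith
      finally show False by simp
    qed
    then show ?thesis using True by (simp add: s_def p_def q_def)
  next
    case False
    have "0 \<le> p\<^sup>2 - 2 * (1 / q\<^sup>2) * (cmod s)\<^sup>2 + (1 / q\<^sup>2)\<^sup>2 * (cmod s)\<^sup>2 * q\<^sup>2" by (rule *)
    also have "\<dots> = p\<^sup>2 - (cmod s)\<^sup>2 / q\<^sup>2"
      using False by (simp add: field_simps power2_eq_square)
    finally have "(cmod s)\<^sup>2 \<le> (p * q)\<^sup>2"
      using False by (simp add: field_simps power_mult_distrib)
    then show ?thesis using pq by (simp add: s_def p_def q_def abs_le_square_iff[symmetric])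
  qed
qed

lemma gns_vnorm_triangle:
  assumes "\<omega> \<in> states"
  shows "gns_vnorm \<omega> (x + y) \<le> gns_vnorm \<omega> x + gns_vnorm \<omega> y"
proof -
  have "(gns_vnorm \<omega> (x + y))\<^sup>2 =
      (gns_vnorm \<omega> x)\<^sup>2 + 2 * Re (\<omega> (star x * y)) + (gns_vnorm \<omega> y)\<^sup>2"
    using gns_form_expand[OF assms, of x 1 y] by (simp only: scaleC_one mult_1 norm_one power_one)
  moreover have "Re (\<omega> (star x * y)) \<le> gns_vnorm \<omega> x * gns_vnorm \<omega> y"
    by (rule order_trans[OF complex_Re_le_cmod gns_Cauchy_Schwarz[OF assms]])
  ultimately have "(gns_vnorm \<omega> (x + y))\<^sup>2 \<le> (gns_vnorm \<omega> x + gns_vnorm \<omega> y)\<^sup>2"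
    unfolding power2_sum by linarith
  then show ?thesis
    by (rule power2_le_imp_le) (intro add_nonneg_nonneg gns_vnorm_sq(2)[OF assms])
qed

lemma gns_vnorm_scaleC:
  assumes "\<omega> \<in> states"
  shows "gns_vnorm \<omega> (c *\<^sub>C x) = cmod c * gns_vnorm \<omega> x"
proof -
  have z: "\<omega> 0 = 0"
    using gns_state_zero[OF assms] .
  then have "(gns_vnorm \<omega> (c *\<^sub>C x))\<^sup>2 = (cmod c * gns_vnorm \<omega> x)\<^sup>2"
    using gns_form_expand[OF assms, of 0 c x]
    by (simp add: power_mult_distrib gns_vnorm_def[of _ 0])
  then show ?thesis
    by (rule power2_eq_imp_eq) (intro mult_nonneg_nonneg norm_ge_zero gns_vnorm_sq(2)[OF assms])+
qed

lemma gns_vnorm_one: "\<omega> \<in> states \<Longrightarrow> gns_vnorm \<omega> 1 = 1"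
  by (simp add: gns_vnorm_def states_def)

text \<open>The GNS representations of \<open>\<R>\<^sub>0\<close> are uniformly bounded.\<close>

definition gns_bound :: "'a::complex_star_algebra \<Rightarrow> real \<Rightarrow> bool" where
  "gns_bound a K \<longleftrightarrow> K \<ge> 0 \<and> (\<forall>\<omega>\<in>states. \<forall>x. gns_vnorm \<omega> (a * x) \<le> K * gns_vnorm \<omega> x)"

lemma gns_bound_mult:
  assumes "gns_bound a K" "gns_bound b L"
  shows "gns_bound (a * b) (K * L)"
  unfolding gns_bound_def
proof (intro conjI ballI allI)
  show "0 \<le> K * L" using assms by (simp add: gns_bound_def)
  fix \<omega> :: "'a \<Rightarrow> complex" and x assume w: "\<omega> \<in> states"
  have "gns_vnorm \<omega> (a * (b * x)) \<le> K * gns_vnorm \<omega> (b * x)"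
    using assms w by (simp add: gns_bound_def)
  also have "\<dots> \<le> K * (L * gns_vnorm \<omega> x)"
    using assms w by (intro mult_left_mono) (auto simp: gns_bound_def)
  finally show "gns_vnorm \<omega> (a * b * x) \<le> K * L * gns_vnorm \<omega> x"
    by (simp add: mult.assoc)
qed

lemma gns_bound_add:
  assumes "gns_bound a K" "gns_bound b L"
  shows "gns_bound (a + b) (K + L)"
  unfolding gns_bound_def
proof (intro conjI ballI allI)
  show "0 \<le> K + L" using assms by (simp add: gns_bound_def)
  fix \<omega> :: "'a \<Rightarrow> complex" and x assume w: "\<omega> \<in> states"
  have "gns_vnorm \<omega> (a * x + b * x) \<le> gns_vnorm \<omega> (a * x) + gns_vnorm \<omega> (b * x)"
    by (rule gns_vnorm_triangle[OF w])
  also have "\<dots> \<le> K * gns_vnorm \<omega> x + L * gns_vnorm \<omega> x"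
    using assms w by (intro add_mono) (auto simp: gns_bound_def)
  finally show "gns_vnorm \<omega> ((a + b) * x) \<le> (K + L) * gns_vnorm \<omega> x"
    by (simp add: distrib_right)
qed

lemma gns_bound_scaleC: "gns_bound a K \<Longrightarrow> gns_bound (c *\<^sub>C a) (cmod c * K)"
  unfolding gns_bound_def mult_scaleC_left
  by (simp add: gns_vnorm_scaleC mult_left_mono mult.assoc)

lemma gns_bound_star_mult:
  assumes "gns_bound (star a * a) K"
  shows "gns_bound a (sqrt K)"
  unfolding gns_bound_def
proof (intro conjI ballI allI)
  show "0 \<le> sqrt K" using assms by (simp add: gns_bound_def)
  fix \<omega> :: "'a \<Rightarrow> complex" and x assume w: "\<omega> \<in> states"
  note nn = gns_vnorm_sq(2)[OF w]
  have "(gns_vnorm \<omega> (a * x))\<^sup>2 = Re (\<omega> (star x * (star a * a * x)))"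
    using arg_cong[OF gns_vnorm_sq(1)[OF w, of "a * x"], of Re]
    by (simp add: star_mult mult.assoc)
  also have "\<dots> \<le> gns_vnorm \<omega> x * gns_vnorm \<omega> (star a * a * x)"
    by (rule order_trans[OF complex_Re_le_cmod gns_Cauchy_Schwarz[OF w]])
  also have "\<dots> \<le> gns_vnorm \<omega> x * (K * gns_vnorm \<omega> x)"
    using assms w nn by (intro mult_left_mono) (auto simp: gns_bound_def)
  also have "\<dots> = (sqrt K * gns_vnorm \<omega> x)\<^sup>2"
    using assms by (simp add: gns_bound_def power_mult_distrib power2_eq_square)
  finally show "gns_vnorm \<omega> (a * x) \<le> sqrt K * gns_vnorm \<omega> x"
    by (rule power2_le_imp_le) (use assms nn in \<open>simp add: gns_bound_def\<close>)
qed

lemma gns_bound_star: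
  assumes "gns_bound a K"
  shows "gns_bound (star a) K"
  unfolding gns_bound_def
proof (intro conjI ballI allI)
  show "0 \<le> K" using assms by (simp add: gns_bound_def)
  fix \<omega> :: "'a \<Rightarrow> complex" and x assume w: "\<omega> \<in> states"
  note nn = gns_vnorm_sq(2)[OF w]
  let ?v = "gns_vnorm \<omega> (star a * x)"
  have "?v\<^sup>2 = Re (\<omega> (star x * (a * (star a * x))))"
    using arg_cong[OF gns_vnorm_sq(1)[OF w, of "star a * x"], of Re]
    by (simp add: star_mult star_star mult.assoc)
  also have "\<dots> \<le> gns_vnorm \<omega> x * gns_vnorm \<omega> (a * (star a * x))"
    by (rule order_trans[OF complex_Re_le_cmod gns_Cauchy_Schwarz[OF w]])
  also have "\<dots> \<le> gns_vnorm \<omega> x * (K * ?v)"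
    using assms w nn by (intro mult_left_mono) (auto simp: gns_bound_def)
  finally have "?v * ?v \<le> (K * gns_vnorm \<omega> x) * ?v"
    by (simp add: power2_eq_square mult_ac)
  then show "?v \<le> K * gns_vnorm \<omega> x"
    using nn[of "star a * x"] nn[of x] \<open>0 \<le> K\<close>
    by (cases "?v = 0") (auto simp: mult_le_cancel_right)
qed

lemma gns_bound_one: "gns_bound 1 1"
  by (simp add: gns_bound_def)

lemma gns_bound_zero: "gns_bound 0 0"
  using gns_bound_scaleC[OF gns_bound_one, of 0] by simp

lemma gns_bound_gen0:
  assumes "l \<noteq> 0"
  shows "gns_bound (gen0 l f) (1 / \<bar>l\<bar>)"
  unfolding gns_bound_def
proof (intro conjI ballI allI)
  fix \<omega> :: "'a resolvent_alg0 \<Rightarrow> complex" and x assume w: "\<omega> \<in> states"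
  note nn = gns_vnorm_sq(2)[OF w]
  define a where "a = gen0 l f"
  let ?v = "gns_vnorm \<omega> (a * x)"
  have st: "star a = gen0 (- l) f"
    unfolding a_def using assms by transfer (rule resolvent_rel.Gen_star)
  have "gen0 m f - gen0 l f = (\<i> * of_real (l - m)) *\<^sub>C (gen0 m f * gen0 l f)" if "m \<noteq> 0" for m
    unfolding minus_resolvent_alg0_def uminus_resolvent_alg0_def
    using assms that by transfer (rule resolvent_rel.Gen_resolvent)
  from this[of "- l"] assms have eq: "(\<i> * of_real (2 * l)) *\<^sub>C (star a * a) = star a - a"
    by (simp add: st a_def[symmetric])
  have sc: "\<omega> (c *\<^sub>C u) = c * \<omega> u" for c u using w by (auto simp: states_def)
  have "(\<i> * of_real (2 * l)) * \<omega> (star (a * x) * (a * x)) =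
      \<omega> (star x * ((\<i> * of_real (2 * l)) *\<^sub>C (star a * a)) * x)"
    by (simp add: mult_scaleC_left mult_scaleC_right sc star_mult mult.assoc)
  also have "\<dots> = \<omega> (star (a * x) * x) - \<omega> (star x * (a * x))"
    unfolding eq by (simp add: algebra_simps gns_state_diff[OF w] star_mult)
  finally have "cmod ((\<i> * of_real (2 * l)) * \<omega> (star (a * x) * (a * x))) \<le>
      cmod (\<omega> (star (a * x) * x)) + cmod (\<omega> (star x * (a * x)))"
    by (simp add: norm_triangle_ineq4)
  also have "\<dots> \<le> ?v * gns_vnorm \<omega> x + gns_vnorm \<omega> x * ?v"
    by (intro add_mono gns_Cauchy_Schwarz w)
  finally have "?v * (\<bar>l\<bar> * ?v) \<le> ?v * gns_vnorm \<omega> x"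
    by (simp add: gns_vnorm_sq(1)[OF w] norm_mult power2_eq_square mult_ac)
  then have "\<bar>l\<bar> * ?v \<le> gns_vnorm \<omega> x"
    using nn[of "a * x"] nn[of x] by (cases "?v = 0") (auto simp: mult_le_cancel_left)
  then show "gns_vnorm \<omega> (gen0 l f * x) \<le> 1 / \<bar>l\<bar> * gns_vnorm \<omega> x"
    using assms by (simp add: a_def field_simps)
qed simp

lemma gns_bounded: "\<exists>K. gns_bound (a::'x::symplectic_space resolvent_alg0) K"
proof -
  have "\<exists>K. gns_bound (abs_resolvent_alg0 t) K" for t :: "'x rterm"
  proof (induction t)
    case (Gen l f)
    show ?case
    proof (cases "l = 0")
      case True
      have "gen0 l f = 0" unfolding True by transfer (rule resolvent_rel.Gen_superfluous)
      then show ?thesis using gns_bound_zero gen0.abs_eq by metis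
    qed (use gns_bound_gen0 gen0.abs_eq in metis)
  qed (metis gns_bound_zero zero_resolvent_alg0_def gns_bound_one one_resolvent_alg0_def
        gns_bound_add plus_resolvent_alg0.abs_eq gns_bound_mult times_resolvent_alg0.abs_eq
        gns_bound_scaleC scaleC_resolvent_alg0.abs_eq gns_bound_star star_resolvent_alg0.abs_eq)+
  from this[of "rep_resolvent_alg0 a"] show ?thesis
    by (simp only: Quotient3_abs_rep[OF Quotient3_resolvent_alg0])
qed

lift_definition state0 :: "'x::symplectic_space resolvent_alg0 \<Rightarrow> complex" is char0
  by (rule char0_rel)

lemma state0_states: "(state0 :: 'x::symplectic_space resolvent_alg0 \<Rightarrow> complex) \<in> states"
proof -
  have "state0 (star x * x) \<in> \<real>\<^sub>\<ge>\<^sub>0" for x :: "'x resolvent_alg0"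
    by transfer (auto simp: complex_nonneg_Reals_iff)
  moreover have "state0 (x + y) = state0 x + state0 y" "state0 (c *\<^sub>C x) = c * state0 x"
    "state0 (1 :: 'x resolvent_alg0) = 1" for x y :: "'x resolvent_alg0" and c
    by (transfer; simp)+
  ultimately show ?thesis by (simp add: states_def)
qed

lemma gns_norm_le:
  assumes "gns_bound a K" "\<omega> \<in> states"
  shows "gns_vnorm \<omega> (a * x) / gns_vnorm \<omega> x \<le> K"
  using assms gns_vnorm_sq(2)[OF assms(2), of x]
  by (cases "gns_vnorm \<omega> x = 0") (auto simp: gns_bound_def field_simps)

lemma max_norm_le:
  assumes "gns_bound (a::'x::symplectic_space resolvent_alg0) K"
  shows "max_norm a \<le> K"
  unfolding max_norm_def gns_norm_def
  using state0_states by (intro cSUP_least gns_norm_le[OF assms]) auto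

lemma gns_bound_max_norm: "gns_bound a (max_norm a)" for a :: "'x::symplectic_space resolvent_alg0"
proof -
  obtain K where K: "gns_bound a K" using gns_bounded by blast
  have *: "gns_vnorm \<omega> (a * x) / gns_vnorm \<omega> x \<le> max_norm a" if w: "\<omega> \<in> states" for \<omega> x
  proof -
    have "gns_vnorm \<omega> (a * x) / gns_vnorm \<omega> x \<le> gns_norm \<omega> a"
      unfolding gns_norm_def using gns_norm_le[OF K w] by (intro cSUP_upper bdd_aboveI2) auto
    also have "\<dots> \<le> max_norm a"
      unfolding max_norm_def using w
    proof (intro cSUP_upper bdd_aboveI2)
      show "gns_norm \<omega> a \<le> K" if "\<omega> \<in> states" for \<omega>
        unfolding gns_norm_def using gns_norm_le[OF K that] by (intro cSUP_least) auto
    qed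
    finally show ?thesis .
  qed
  show ?thesis
    unfolding gns_bound_def
  proof (intro conjI ballI allI)
    show "0 \<le> max_norm a"
    proof (rule order_trans)
      show "0 \<le> gns_vnorm state0 a" by (rule gns_vnorm_sq(2)[OF state0_states])
      show "gns_vnorm state0 a \<le> max_norm a"
        using *[OF state0_states, of 1] by (simp add: gns_vnorm_one[OF state0_states])
    qed
    fix \<omega> x assume w: "\<omega> \<in> (states :: ('x resolvent_alg0 \<Rightarrow> complex) set)"
    show "gns_vnorm \<omega> (a * x) \<le> max_norm a * gns_vnorm \<omega> x"
    proof (cases "gns_vnorm \<omega> x = 0")
      case True
      have "gns_vnorm \<omega> (a * x) \<le> K * gns_vnorm \<omega> x"
        using K w unfolding gns_bound_def by blast
      then show ?thesis using True by simp
    next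
      case False
      with gns_vnorm_sq(2)[OF w, of x] have "gns_vnorm \<omega> x > 0" by simp
      then show ?thesis using *[OF w, of x] by (simp add: field_simps)
    qed
  qed
qed

context
  fixes a b :: "'x::symplectic_space resolvent_alg0"
begin

lemma max_norm_nonneg: "max_norm a \<ge> 0"
  using gns_bound_max_norm[of a] by (simp add: gns_bound_def)

lemma max_norm_triangle: "max_norm (a + b) \<le> max_norm a + max_norm b"
  by (intro max_norm_le gns_bound_add gns_bound_max_norm)

lemma max_norm_mult: "max_norm (a * b) \<le> max_norm a * max_norm b"
  by (intro max_norm_le gns_bound_mult gns_bound_max_norm)

lemma max_norm_star_le: "max_norm (star a) \<le> max_norm a"
  by (intro max_norm_le gns_bound_star gns_bound_max_norm)

lemma max_norm_scaleC_le: "max_norm (c *\<^sub>C a) \<le> cmod c * max_norm a"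
  by (intro max_norm_le gns_bound_scaleC gns_bound_max_norm)

lemma max_norm_le_sqrt: "max_norm a \<le> sqrt (max_norm (star a * a))"
  by (intro max_norm_le gns_bound_star_mult gns_bound_max_norm)

end

lemma max_norm_zero: "max_norm (0::'x::symplectic_space resolvent_alg0) = 0"
  using max_norm_le[OF gns_bound_zero, where 'x='x] max_norm_nonneg[of "0::'x resolvent_alg0"] by simp

lemma max_norm_one: "max_norm (1::'x::symplectic_space resolvent_alg0) = 1"
proof (rule antisym)
  show "max_norm (1::'x resolvent_alg0) \<le> 1" by (rule max_norm_le[OF gns_bound_one])
  show "1 \<le> max_norm (1::'x resolvent_alg0)"
    using gns_bound_max_norm[of "1::'x resolvent_alg0"] state0_states gns_vnorm_one[OF state0_states]
    unfolding gns_bound_def by (metis mult.right_neutral)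
qed

lemma max_norm_scaleC: "max_norm (c *\<^sub>C a) = cmod c * max_norm a"
  for a :: "'x::symplectic_space resolvent_alg0"
proof (cases "c = 0")
  case False
  have "max_norm a \<le> cmod (inverse c) * max_norm (c *\<^sub>C a)"
    using max_norm_scaleC_le[of "inverse c" "c *\<^sub>C a"] False by (simp add: scaleC_scaleC scaleC_one)
  then have "cmod c * max_norm a \<le> max_norm (c *\<^sub>C a)"
    using False by (simp add: norm_inverse norm_divide field_simps)
  then show ?thesis using max_norm_scaleC_le[of c a] by simp
qed (simp add: max_norm_zero)

lemma max_norm_star: "max_norm (star a) = max_norm a"
  for a :: "'x::symplectic_space resolvent_alg0"
  using max_norm_star_le[of a] max_norm_star_le[of "star a"] by (simp add: star_star)

lemma max_norm_cstar: "max_norm (star a * a) = (max_norm a)\<^sup>2"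
  for a :: "'x::symplectic_space resolvent_alg0"
proof (rule antisym)
  show "max_norm (star a * a) \<le> (max_norm a)\<^sup>2"
    using max_norm_mult[of "star a" a] by (simp add: max_norm_star power2_eq_square)
  have "(max_norm a)\<^sup>2 \<le> (sqrt (max_norm (star a * a)))\<^sup>2"
    by (intro power_mono max_norm_le_sqrt max_norm_nonneg)
  then show "(max_norm a)\<^sup>2 \<le> max_norm (star a * a)"
    using max_norm_nonneg[of "star a * a"] by simp
qed

lemma max_norm_uminus: "max_norm (- a) = max_norm a"
  for a :: "'x::symplectic_space resolvent_alg0"
  using max_norm_scaleC[of "-1" a] by simp

lemma max_norm_minus_commute: "max_norm (a - b) = max_norm (b - a)"
  for a :: "'x::symplectic_space resolvent_alg0"
  using max_norm_uminus[of "a - b"] by simp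


section \<open>The quotient by the kernel of the seminorm\<close>

definition null_rel :: "'x::symplectic_space resolvent_alg0 \<Rightarrow> 'x resolvent_alg0 \<Rightarrow> bool" where
  "null_rel a b \<longleftrightarrow> max_norm (a - b) = 0"

lemma null_rel_sum:
  assumes "max_norm (a::'x::symplectic_space resolvent_alg0) = 0" "max_norm b = 0"
  shows "max_norm (a + b) = 0"
  using max_norm_triangle[of a b] max_norm_nonneg[of "a + b"] assms by simp

lemma null_rel_mult:
  assumes "max_norm (a::'x::symplectic_space resolvent_alg0) = 0"
  shows "max_norm (a * b) = 0" "max_norm (b * a) = 0"
  using max_norm_mult[of a b] max_norm_nonneg[of "a * b"] max_norm_mult[of b a]
    max_norm_nonneg[of "b * a"] assms by simp_all

lemma null_rel_norm:
  assumes "null_rel a b"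
  shows "max_norm a = max_norm b"
  using max_norm_triangle[of "a - b" b] max_norm_triangle[of "b - a" a]
    assms max_norm_minus_commute[of a b] by (simp add: null_rel_def)

quotient_type (overloaded) 'x resolvent_quot = "'x::symplectic_space resolvent_alg0" / null_rel
proof (intro equivpI reflpI sympI transpI)
  fix a b c :: "'x resolvent_alg0"
  show "null_rel a a" by (simp add: null_rel_def max_norm_zero)
  show "null_rel a b \<Longrightarrow> null_rel b a" by (simp add: null_rel_def max_norm_minus_commute)
  show "null_rel a b \<Longrightarrow> null_rel b c \<Longrightarrow> null_rel a c"
    using null_rel_sum[of "a - b" "b - c"] by (simp add: null_rel_def)
qed

instantiation resolvent_quot :: (symplectic_space) pre_cstar_algebra
begin

lift_definition zero_resolvent_quot :: "'a resolvent_quot" is 0 .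
lift_definition one_resolvent_quot :: "'a resolvent_quot" is 1 .
lift_definition plus_resolvent_quot :: "'a resolvent_quot \<Rightarrow> 'a resolvent_quot \<Rightarrow> 'a resolvent_quot"
  is "(+)" unfolding null_rel_def by (metis add_diff_add null_rel_sum)
lift_definition uminus_resolvent_quot :: "'a resolvent_quot \<Rightarrow> 'a resolvent_quot"
  is uminus by (simp add: null_rel_def) (metis max_norm_minus_commute)
lift_definition minus_resolvent_quot :: "'a resolvent_quot \<Rightarrow> 'a resolvent_quot \<Rightarrow> 'a resolvent_quot"
  is "(-)"
proof -
  fix a b c d :: "'a resolvent_alg0" assume "null_rel a b" "null_rel c d"
  then have "max_norm ((a - b) + (d - c)) = 0"
    using max_norm_minus_commute[of c d] by (intro null_rel_sum) (auto simp: null_rel_def)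
  then show "null_rel (a - c) (b - d)" by (simp add: null_rel_def algebra_simps)
qed
lift_definition times_resolvent_quot :: "'a resolvent_quot \<Rightarrow> 'a resolvent_quot \<Rightarrow> 'a resolvent_quot"
  is "(*)"
proof -
  fix a b c d :: "'a resolvent_alg0" assume "null_rel a b" "null_rel c d"
  then have "max_norm ((a - b) * c + b * (c - d)) = 0"
    by (intro null_rel_sum null_rel_mult) (auto simp: null_rel_def)
  then show "null_rel (a * c) (b * d)" by (simp add: null_rel_def algebra_simps)
qed
lift_definition scaleC_resolvent_quot :: "complex \<Rightarrow> 'a resolvent_quot \<Rightarrow> 'a resolvent_quot"
  is "(*\<^sub>C)"
  by (simp add: null_rel_def complex_vector.scale_right_diff_distrib[symmetric] max_norm_scaleC)
lift_definition scaleR_resolvent_quot :: "real \<Rightarrow> 'a resolvent_quot \<Rightarrow> 'a resolvent_quot"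
  is "(*\<^sub>R)"
  by (simp add: null_rel_def scaleR_right_diff_distrib[symmetric])
    (simp add: scaleR_scaleC max_norm_scaleC)
lift_definition star_resolvent_quot :: "'a resolvent_quot \<Rightarrow> 'a resolvent_quot"
  is star
proof -
  fix a b :: "'a resolvent_alg0" assume "null_rel a b"
  have "star (a - b) + star b = star a" by (simp add: star_add[symmetric])
  then have "star a - star b = star (a - b)" by (simp add: algebra_simps)
  then show "null_rel (star a) (star b)" using \<open>null_rel a b\<close> by (simp add: null_rel_def max_norm_star)
qed
lift_definition norm_resolvent_quot :: "'a resolvent_quot \<Rightarrow> real"
  is max_norm by (rule null_rel_norm)
definition sgn_resolvent_quot :: "'a resolvent_quot \<Rightarrow> 'a resolvent_quot"
  where "sgn x = inverse (norm x) *\<^sub>R x" for x :: "'a resolvent_quot"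
definition dist_resolvent_quot :: "'a resolvent_quot \<Rightarrow> 'a resolvent_quot \<Rightarrow> real"
  where "dist x y = norm (x - y)" for x y :: "'a resolvent_quot"
definition uniformity_resolvent_quot :: "('a resolvent_quot \<times> 'a resolvent_quot) filter"
  where "uniformity_resolvent_quot = (INF e\<in>{0 <..}. principal {(x, y). dist x y < e})"
definition open_resolvent_quot :: "'a resolvent_quot set \<Rightarrow> bool"
  where "open U \<longleftrightarrow> (\<forall>x\<in>U. \<forall>\<^sub>F (x', y) in uniformity. x' = x \<longrightarrow> y \<in> U)" for U :: "'a resolvent_quot set"

instance
proof
  have eq: "a = b \<Longrightarrow> null_rel a b" for a b :: "'a resolvent_alg0"
    by (simp add: null_rel_def max_norm_zero)
  fix x y z :: "'a resolvent_quot" and c d :: complex and r q :: real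
  show "x + y + z = x + (y + z)" by transfer (simp add: eq add.assoc)
  show "x + y = y + x" by transfer (simp add: eq add.commute)
  show "0 + x = x" by transfer (simp add: eq)
  show "- x + x = 0" by transfer (simp add: eq)
  show "x - y = x + - y" by transfer (simp add: eq)
  show "x * y * z = x * (y * z)" by transfer (simp add: eq mult.assoc)
  show "1 * x = x" by transfer (simp add: eq)
  show "x * 1 = x" by transfer (simp add: eq)
  show "(x + y) * z = x * z + y * z" by transfer (simp add: eq distrib_right)
  show "x * (y + z) = x * y + x * z" by transfer (simp add: eq distrib_left)
  show "(0::'a resolvent_quot) \<noteq> 1"
    by transfer (simp add: null_rel_def max_norm_uminus max_norm_one)
  show "c *\<^sub>C (x + y) = c *\<^sub>C x + c *\<^sub>C y" by transfer (simp add: eq scaleC_add_right)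
  show "(c + d) *\<^sub>C x = c *\<^sub>C x + d *\<^sub>C x" by transfer (simp add: eq scaleC_add_left)
  show "c *\<^sub>C d *\<^sub>C x = (c * d) *\<^sub>C x" by transfer (simp add: eq scaleC_scaleC)
  show "1 *\<^sub>C x = x" by transfer (simp add: eq scaleC_one)
  show "r *\<^sub>R x = complex_of_real r *\<^sub>C x" by transfer (simp add: eq scaleR_scaleC)
  show "(c *\<^sub>C x) * y = c *\<^sub>C (x * y)" by transfer (simp add: eq mult_scaleC_left)
  show "x * (c *\<^sub>C y) = c *\<^sub>C (x * y)" by transfer (simp add: eq mult_scaleC_right)
  show "r *\<^sub>R (x + y) = r *\<^sub>R x + r *\<^sub>R y" by transfer (simp add: eq scaleR_add_right)
  show "(r + q) *\<^sub>R x = r *\<^sub>R x + q *\<^sub>R x" by transfer (simp add: eq scaleR_add_left)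
  show "r *\<^sub>R q *\<^sub>R x = (r * q) *\<^sub>R x" by transfer (simp add: eq)
  show "1 *\<^sub>R x = x" by transfer (simp add: eq)
  show "r *\<^sub>R x * y = r *\<^sub>R (x * y)" by transfer (simp add: eq)
  show "x * r *\<^sub>R y = r *\<^sub>R (x * y)" by transfer (simp add: eq)
  show "star (x + y) = star x + star y" by transfer (simp add: eq star_add)
  show "star (c *\<^sub>C x) = cnj c *\<^sub>C star x" by transfer (simp add: eq star_scaleC)
  show "star (x * y) = star y * star x" by transfer (simp add: eq star_mult)
  show "star (star x) = x" by transfer (simp add: eq star_star)
  show "norm x = 0 \<longleftrightarrow> x = 0" by transfer (simp add: null_rel_def)
  show "norm (x + y) \<le> norm x + norm y" by transfer (rule max_norm_triangle)
  show "norm (r *\<^sub>R x) = \<bar>r\<bar> * norm x" by transfer (simp add: scaleR_scaleC max_norm_scaleC)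
  show "norm (x * y) \<le> norm x * norm y" by transfer (rule max_norm_mult)
  show "norm (1::'a resolvent_quot) = 1" by transfer (rule max_norm_one)
  show "norm (c *\<^sub>C x) = cmod c * norm x" by transfer (rule max_norm_scaleC)
  show "norm (star x * x) = (norm x)\<^sup>2" by transfer (rule max_norm_cstar)
qed (rule sgn_resolvent_quot_def dist_resolvent_quot_def uniformity_resolvent_quot_def
    open_resolvent_quot_def)+

end


section \<open>Completion\<close>

text \<open>Cauchy sequences modulo null sequences, with the pointwise operations.\<close>

definition completion_rel :: "(nat \<Rightarrow> 'a::pre_cstar_algebra) \<Rightarrow> (nat \<Rightarrow> 'a) \<Rightarrow> bool" where
  "completion_rel X Y \<longleftrightarrow> Cauchy X \<and> Cauchy Y \<and> (\<lambda>n. X n - Y n) \<longlonglongrightarrow> 0"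

lemma norm_star: "norm (star x) = norm x" for x :: "'a::pre_cstar_algebra"
proof -
  have *: "norm y \<le> norm (star y)" for y :: 'a
  proof (cases "norm y = 0")
    case False
    have "norm y * norm y \<le> norm (star y) * norm y"
      using norm_mult_ineq[of "star y" y] by (simp add: cstar_identity power2_eq_square)
    then show ?thesis using False by simp
  qed simp
  show ?thesis using *[of x] *[of "star x"] by (simp add: star_star)
qed

lemma star_diff: "star (x - y) = star x - star y" for x :: "'a::complex_star_algebra"
proof -
  have "star (x - y) + star y = star x" by (simp add: star_add[symmetric])
  then show ?thesis by (simp add: algebra_simps)
qed

lemma bounded_linear_star: "bounded_linear (star :: 'a \<Rightarrow> 'a::pre_cstar_algebra)"
  by (rule bounded_linear_intro[of _ 1])
    (simp_all add: star_add scaleR_scaleC star_scaleC norm_star)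

lemma bounded_linear_scaleC: "bounded_linear ((*\<^sub>C) c :: 'a \<Rightarrow> 'a::pre_cstar_algebra)"
  by (rule bounded_linear_intro[of _ "cmod c"])
    (simp_all add: scaleC_add_right scaleR_scaleC scaleC_scaleC norm_scaleC mult_ac)

lemma Cauchy_plus:
  fixes X Y :: "nat \<Rightarrow> 'a::real_normed_vector"
  assumes "Cauchy X" "Cauchy Y"
  shows "Cauchy (\<lambda>n. X n + Y n)"
proof (rule CauchyI)
  fix e :: real assume "e > 0"
  then have e: "e / 2 > 0" by simp
  obtain M N where M: "\<And>m n. m \<ge> M \<Longrightarrow> n \<ge> M \<Longrightarrow> norm (X m - X n) < e / 2"
    and N: "\<And>m n. m \<ge> N \<Longrightarrow> n \<ge> N \<Longrightarrow> norm (Y m - Y n) < e / 2"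
    using CauchyD[OF assms(1) e] CauchyD[OF assms(2) e] by metis
  show "\<exists>M. \<forall>m\<ge>M. \<forall>n\<ge>M. norm (X m + Y m - (X n + Y n)) < e"
  proof (intro exI[of _ "max M N"] allI impI)
    fix m n assume "m \<ge> max M N" "n \<ge> max M N"
    then have "norm (X m - X n) + norm (Y m - Y n) < e"
      using M[of m n] N[of m n] by simp
    then show "norm (X m + Y m - (X n + Y n)) < e"
      unfolding add_diff_add by (rule le_less_trans[OF norm_triangle_ineq])
  qed
qed

lemma Cauchy_uminus: "Cauchy X \<Longrightarrow> Cauchy (\<lambda>n. - X n)" for X :: "nat \<Rightarrow> 'a::real_normed_vector"
  by (rule bounded_linear.Cauchy[OF bounded_linear_minus[OF bounded_linear_ident]])

lemma Cauchy_minus: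
  fixes X Y :: "nat \<Rightarrow> 'a::real_normed_vector"
  shows "Cauchy X \<Longrightarrow> Cauchy Y \<Longrightarrow> Cauchy (\<lambda>n. X n - Y n)"
  using Cauchy_plus[of X "\<lambda>n. - Y n"] Cauchy_uminus[of Y] by simp

lemma Cauchy_times:
  fixes X Y :: "nat \<Rightarrow> 'a::real_normed_algebra"
  assumes "Cauchy X" "Cauchy Y"
  shows "Cauchy (\<lambda>n. X n * Y n)"
proof (rule CauchyI)
  fix e :: real assume "e > 0"
  obtain K L where K: "K > 0" "\<And>n. norm (X n) \<le> K" and L: "L > 0" "\<And>n. norm (Y n) \<le> L"
    using Cauchy_Bseq[OF assms(1)] Cauchy_Bseq[OF assms(2)] by (metis BseqE)
  have e: "e / 2 / L > 0" "e / 2 / K > 0" using K L \<open>e > 0\<close> by simp_all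
  obtain M N where M: "\<And>m n. m \<ge> M \<Longrightarrow> n \<ge> M \<Longrightarrow> norm (X m - X n) < e / 2 / L"
    and N: "\<And>m n. m \<ge> N \<Longrightarrow> n \<ge> N \<Longrightarrow> norm (Y m - Y n) < e / 2 / K"
    using CauchyD[OF assms(1) e(1)] CauchyD[OF assms(2) e(2)] by metis
  show "\<exists>M. \<forall>m\<ge>M. \<forall>n\<ge>M. norm (X m * Y m - X n * Y n) < e"
  proof (intro exI[of _ "max M N"] allI impI)
    fix m n assume mn: "m \<ge> max M N" "n \<ge> max M N"
    have "norm (X m * Y m - X n * Y n) = norm ((X m - X n) * Y m + X n * (Y m - Y n))"
      by (simp add: algebra_simps)
    also have "\<dots> \<le> norm ((X m - X n) * Y m) + norm (X n * (Y m - Y n))"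
      by (rule norm_triangle_ineq)
    also have "\<dots> \<le> norm (X m - X n) * norm (Y m) + norm (X n) * norm (Y m - Y n)"
      by (intro add_mono norm_mult_ineq)
    also have "\<dots> \<le> norm (X m - X n) * L + K * norm (Y m - Y n)"
      using K L by (intro add_mono mult_left_mono mult_right_mono) auto
    also have "\<dots> < e / 2 / L * L + K * (e / 2 / K)"
      using K L M[of m n] N[of m n] mn
      by (intro add_strict_mono mult_strict_left_mono mult_strict_right_mono) auto
    also have "\<dots> = e" using K L by simp
    finally show "norm (X m * Y m - X n * Y n) < e" .
  qed
qed

lemma Cauchy_norm: "Cauchy X \<Longrightarrow> Cauchy (\<lambda>n. norm (X n))" for X :: "nat \<Rightarrow> 'a::real_normed_vector"
  unfolding Cauchy_iff by (metis norm_triangle_ineq3 order_le_less_trans real_norm_def)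

lemma Cauchy_const': "Cauchy (\<lambda>n. c :: 'a::real_normed_vector)"
  by (rule CauchyI) auto

lemma completion_rel_refl: "Cauchy X \<Longrightarrow> completion_rel X X"
  by (simp add: completion_rel_def)

quotient_type (overloaded) 'a completion = "nat \<Rightarrow> 'a::pre_cstar_algebra" / partial: completion_rel
proof (intro part_equivpI sympI transpI)
  show "\<exists>X. completion_rel X (X :: nat \<Rightarrow> 'a)"
    using completion_rel_refl Cauchy_const' by blast
  fix X Y Z :: "nat \<Rightarrow> 'a"
  show "completion_rel X Y \<Longrightarrow> completion_rel Y X"
    unfolding completion_rel_def using tendsto_minus[of "\<lambda>n. X n - Y n" 0] by simp
  show "completion_rel X Y \<Longrightarrow> completion_rel Y Z \<Longrightarrow> completion_rel X Z"
    unfolding completion_rel_def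
    using tendsto_add[of "\<lambda>n. X n - Y n" 0 _ "\<lambda>n. Y n - Z n" 0] by simp
qed

lemma completion_rel_times:
  assumes "completion_rel X X'" "completion_rel Y Y'"
  shows "completion_rel (\<lambda>n. X n * Y n) (\<lambda>n. X' n * Y' n)"
proof -
  have C: "Cauchy X" "Cauchy X'" "Cauchy Y" "Cauchy Y'"
    and Z: "Zfun (\<lambda>n. X n - X' n) sequentially" "Zfun (\<lambda>n. Y n - Y' n) sequentially"
    using assms by (auto simp: completion_rel_def tendsto_Zfun_iff)
  have B: "Bfun Y sequentially" "Bfun X' sequentially"
    using Cauchy_Bseq C by auto
  have "Zfun (\<lambda>n. (X n - X' n) * Y n + X' n * (Y n - Y' n)) sequentially"
    by (intro Zfun_add bounded_bilinear.Zfun_prod_Bfun[OF bounded_bilinear_mult Z(1) B(1)]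
        bounded_bilinear.Bfun_prod_Zfun[OF bounded_bilinear_mult B(2) Z(2)])
  then show ?thesis
    using C by (simp add: completion_rel_def Cauchy_times tendsto_Zfun_iff algebra_simps)
qed

lemma completion_rel_bounded_linear:
  assumes "bounded_linear f" "completion_rel X X'"
  shows "completion_rel (\<lambda>n. f (X n)) (\<lambda>n. f (X' n))"
proof -
  interpret bounded_linear f by fact
  show ?thesis
    using assms(2) tendsto_zero[of "\<lambda>n. X n - X' n"] by (simp add: completion_rel_def Cauchy diff)
qed

lemma completion_rel_norm:
  assumes "completion_rel X X'"
  shows "lim (\<lambda>n. norm (X n)) = lim (\<lambda>n. norm (X' n))"
proof -
  have "convergent (\<lambda>n. norm (X' n))"
    using assms by (auto simp: completion_rel_def Cauchy_convergent_iff[symmetric] Cauchy_norm)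
  then have l: "(\<lambda>n. norm (X' n)) \<longlonglongrightarrow> lim (\<lambda>n. norm (X' n))"
    by (simp add: convergent_LIMSEQ_iff)
  have "(\<lambda>n. norm (X n) - norm (X' n)) \<longlonglongrightarrow> 0"
  proof (rule Lim_null_comparison)
    show "\<forall>\<^sub>F n in sequentially. norm (norm (X n) - norm (X' n)) \<le> norm (X n - X' n)"
      by (simp add: norm_triangle_ineq3)
    show "(\<lambda>n. norm (X n - X' n)) \<longlonglongrightarrow> 0"
      using assms by (auto simp: completion_rel_def intro: tendsto_norm_zero)
  qed
  from tendsto_add[OF this l] show ?thesis by (simp add: limI)
qed

lemma completion_rel_lim:
  assumes "completion_rel X X'"
  shows "(\<lambda>n. norm (X n)) \<longlonglongrightarrow> lim (\<lambda>n. norm (X n))"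
  using assms
  by (auto simp: completion_rel_def Cauchy_convergent_iff[symmetric] Cauchy_norm convergent_LIMSEQ_iff[symmetric])

instantiation completion :: (pre_cstar_algebra) pre_cstar_algebra
begin

lift_definition zero_completion :: "'a completion" is "\<lambda>n. 0"
  by (intro completion_rel_refl Cauchy_const')
lift_definition one_completion :: "'a completion" is "\<lambda>n. 1"
  by (intro completion_rel_refl Cauchy_const')
lift_definition plus_completion :: "'a completion \<Rightarrow> 'a completion \<Rightarrow> 'a completion"
  is "\<lambda>X Y n. X n + Y n"
  by (auto simp: completion_rel_def Cauchy_plus add_diff_add intro: tendsto_add_zero)
lift_definition minus_completion :: "'a completion \<Rightarrow> 'a completion \<Rightarrow> 'a completion"
  is "\<lambda>X Y n. X n - Y n"
proof -
  fix X X' Y Y' :: "nat \<Rightarrow> 'a" assume "completion_rel X X'" "completion_rel Y Y'"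
  then have "Cauchy X" "Cauchy X'" "Cauchy Y" "Cauchy Y'"
    "(\<lambda>n. (X n - X' n) - (Y n - Y' n)) \<longlonglongrightarrow> 0 - 0"
    by (auto simp: completion_rel_def intro!: tendsto_diff[of _ 0 _ _ 0, simplified])
  then show "completion_rel (\<lambda>n. X n - Y n) (\<lambda>n. X' n - Y' n)"
    by (simp add: completion_rel_def Cauchy_minus algebra_simps)
qed
lift_definition uminus_completion :: "'a completion \<Rightarrow> 'a completion" is "\<lambda>X n. - X n"
  by (rule completion_rel_bounded_linear[OF bounded_linear_minus[OF bounded_linear_ident]])
lift_definition times_completion :: "'a completion \<Rightarrow> 'a completion \<Rightarrow> 'a completion"
  is "\<lambda>X Y n. X n * Y n" by (rule completion_rel_times)
lift_definition scaleR_completion :: "real \<Rightarrow> 'a completion \<Rightarrow> 'a completion"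
  is "\<lambda>r X n. r *\<^sub>R X n" by (rule completion_rel_bounded_linear[OF bounded_linear_scaleR_right])
lift_definition scaleC_completion :: "complex \<Rightarrow> 'a completion \<Rightarrow> 'a completion"
  is "\<lambda>c X n. c *\<^sub>C X n" by (rule completion_rel_bounded_linear[OF bounded_linear_scaleC])
lift_definition star_completion :: "'a completion \<Rightarrow> 'a completion"
  is "\<lambda>X n. star (X n)" by (rule completion_rel_bounded_linear[OF bounded_linear_star])
lift_definition norm_completion :: "'a completion \<Rightarrow> real"
  is "\<lambda>X. lim (\<lambda>n. norm (X n))" by (rule completion_rel_norm)
definition sgn_completion :: "'a completion \<Rightarrow> 'a completion"
  where "sgn x = inverse (norm x) *\<^sub>R x" for x :: "'a completion"
definition dist_completion :: "'a completion \<Rightarrow> 'a completion \<Rightarrow> real"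
  where "dist x y = norm (x - y)" for x y :: "'a completion"
definition uniformity_completion :: "('a completion \<times> 'a completion) filter"
  where "uniformity_completion = (INF e\<in>{0 <..}. principal {(x, y). dist x y < e})"
definition open_completion :: "'a completion set \<Rightarrow> bool"
  where "open U \<longleftrightarrow> (\<forall>x\<in>U. \<forall>\<^sub>F (x', y) in uniformity. x' = x \<longrightarrow> y \<in> U)" for U :: "'a completion set"

instance
proof
  have CD: "completion_rel X X \<longleftrightarrow> Cauchy X" for X :: "nat \<Rightarrow> 'a"
    by (auto simp: completion_rel_def)
  note C = CD Cauchy_minus Cauchy_plus Cauchy_uminus Cauchy_times Cauchy_const' CD
    bounded_linear.Cauchy[OF bounded_linear_scaleR_right] bounded_linear.Cauchy[OF bounded_linear_scaleC]
    bounded_linear.Cauchy[OF bounded_linear_star]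
  fix x y z :: "'a completion" and c d :: complex and r q :: real
  show "x + y + z = x + (y + z)" by transfer (simp add: C add.assoc)
  show "x + y = y + x" by transfer (simp add: C add.commute)
  show "0 + x = x" by transfer (simp add: C)
  show "- x + x = 0" by transfer (simp add: C)
  show "x - y = x + - y" by transfer (simp add: C)
  show "x * y * z = x * (y * z)" by transfer (simp add: C mult.assoc)
  show "1 * x = x" by transfer (simp add: C)
  show "x * 1 = x" by transfer (simp add: C)
  show "(x + y) * z = x * z + y * z" by transfer (simp add: C distrib_right)
  show "x * (y + z) = x * y + x * z" by transfer (simp add: C distrib_left)
  show "(0::'a completion) \<noteq> 1"
    by transfer (auto simp: completion_rel_def LIMSEQ_const_iff)
  show "c *\<^sub>C (x + y) = c *\<^sub>C x + c *\<^sub>C y" by transfer (simp add: C scaleC_add_right)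
  show "(c + d) *\<^sub>C x = c *\<^sub>C x + d *\<^sub>C x" by transfer (simp add: C scaleC_add_left)
  show "c *\<^sub>C d *\<^sub>C x = (c * d) *\<^sub>C x" by transfer (simp add: C scaleC_scaleC)
  show "1 *\<^sub>C x = x" by transfer (simp add: C scaleC_one)
  show "r *\<^sub>R x = complex_of_real r *\<^sub>C x" by transfer (simp add: C scaleR_scaleC)
  show "(c *\<^sub>C x) * y = c *\<^sub>C (x * y)" by transfer (simp add: C mult_scaleC_left)
  show "x * (c *\<^sub>C y) = c *\<^sub>C (x * y)" by transfer (simp add: C mult_scaleC_right)
  show "r *\<^sub>R (x + y) = r *\<^sub>R x + r *\<^sub>R y" by transfer (simp add: C scaleR_add_right)
  show "(r + q) *\<^sub>R x = r *\<^sub>R x + q *\<^sub>R x" by transfer (simp add: C scaleR_add_left)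
  show "r *\<^sub>R q *\<^sub>R x = (r * q) *\<^sub>R x" by transfer (simp add: C)
  show "1 *\<^sub>R x = x" by transfer (simp add: C)
  show "r *\<^sub>R x * y = r *\<^sub>R (x * y)" by transfer (simp add: C)
  show "x * r *\<^sub>R y = r *\<^sub>R (x * y)" by transfer (simp add: C)
  show "star (x + y) = star x + star y" by transfer (simp add: C star_add)
  show "star (c *\<^sub>C x) = cnj c *\<^sub>C star x" by transfer (simp add: C star_scaleC)
  show "star (x * y) = star y * star x" by transfer (simp add: C star_mult)
  show "star (star x) = x" by transfer (simp add: C star_star)
  show "norm x = 0 \<longleftrightarrow> x = 0"
  proof transfer
    fix X :: "nat \<Rightarrow> 'a" assume X: "completion_rel X X"
    have "lim (\<lambda>n. norm (X n)) = 0 \<longleftrightarrow> (\<lambda>n. norm (X n)) \<longlonglongrightarrow> 0"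
      using completion_rel_lim[OF X] LIMSEQ_unique by metis
    then show "lim (\<lambda>n. norm (X n)) = 0 \<longleftrightarrow> completion_rel X (\<lambda>n. 0)"
      using X CD by (simp add: completion_rel_def Cauchy_const' tendsto_norm_zero_iff)
  qed
  show "norm (x + y) \<le> norm x + norm y"
  proof transfer
    fix X Y :: "nat \<Rightarrow> 'a" assume X: "completion_rel X X" and Y: "completion_rel Y Y"
    have "completion_rel (\<lambda>n. X n + Y n) (\<lambda>n. X n + Y n)" using X Y by (simp add: C)
    from completion_rel_lim[OF this] tendsto_add[OF completion_rel_lim[OF X] completion_rel_lim[OF Y]]
    show "lim (\<lambda>n. norm (X n + Y n)) \<le> lim (\<lambda>n. norm (X n)) + lim (\<lambda>n. norm (Y n))"
      by (rule LIMSEQ_le) (auto intro: norm_triangle_ineq)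
  qed
  show "norm (x * y) \<le> norm x * norm y"
  proof transfer
    fix X Y :: "nat \<Rightarrow> 'a" assume X: "completion_rel X X" and Y: "completion_rel Y Y"
    have "completion_rel (\<lambda>n. X n * Y n) (\<lambda>n. X n * Y n)" using X Y by (simp add: C)
    from completion_rel_lim[OF this] tendsto_mult[OF completion_rel_lim[OF X] completion_rel_lim[OF Y]]
    show "lim (\<lambda>n. norm (X n * Y n)) \<le> lim (\<lambda>n. norm (X n)) * lim (\<lambda>n. norm (Y n))"
      by (rule LIMSEQ_le) (auto intro: norm_mult_ineq)
  qed
  show *: "norm (c *\<^sub>C x) = cmod c * norm x" for c
  proof transfer
    fix c and X :: "nat \<Rightarrow> 'a" assume X: "completion_rel X X"
    show "lim (\<lambda>n. norm (c *\<^sub>C X n)) = cmod c * lim (\<lambda>n. norm (X n))"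
      using tendsto_mult[OF tendsto_const completion_rel_lim[OF X]]
      by (simp add: limI norm_scaleC)
  qed
  have "r *\<^sub>R x = complex_of_real r *\<^sub>C x" by transfer (simp add: C scaleR_scaleC)
  then show "norm (r *\<^sub>R x) = \<bar>r\<bar> * norm x" by (simp add: *)
  show "norm (1::'a completion) = 1" by transfer (simp add: limI)
  show "norm (star x * x) = (norm x)\<^sup>2"
  proof transfer
    fix X :: "nat \<Rightarrow> 'a" assume X: "completion_rel X X"
    show "lim (\<lambda>n. norm (star (X n) * X n)) = (lim (\<lambda>n. norm (X n)))\<^sup>2"
      using tendsto_power[OF completion_rel_lim[OF X]]
      by (simp add: limI cstar_identity)
  qed
qed (rule sgn_completion_def dist_completion_def uniformity_completion_def open_completion_def)+

end

lift_definition completion_embed :: "'a::pre_cstar_algebra \<Rightarrow> 'a completion" is "\<lambda>x n. x"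
  by (intro completion_rel_refl Cauchy_const')

lemma norm_completion_embed: "norm (completion_embed x - completion_embed y) = norm (x - y)"
  by transfer (simp add: limI)

lemma completion_embed_lim:
  assumes "Cauchy X"
  shows "(\<lambda>n. completion_embed (X n)) \<longlonglongrightarrow> abs_completion X"
proof (rule metric_LIMSEQ_I)
  fix e :: real assume "e > 0"
  then obtain N where N: "\<And>m n. m \<ge> N \<Longrightarrow> n \<ge> N \<Longrightarrow> norm (X m - X n) < e / 2"
    using CauchyD[OF assms, of "e / 2"] by (metis half_gt_zero)
  have "dist (completion_embed (X n)) (abs_completion X) < e" if "n \<ge> N" for n
  proof -
    have "completion_embed (X n) - abs_completion X = abs_completion (\<lambda>k. X n - X k)"
      using assms by (simp add: completion_embed.abs_eq minus_completion.abs_eq completion_rel_refl Cauchy_const')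
    moreover have C: "completion_rel (\<lambda>k. X n - X k) (\<lambda>k. X n - X k)"
      by (intro completion_rel_refl Cauchy_minus Cauchy_const' assms)
    ultimately have "dist (completion_embed (X n)) (abs_completion X) = lim (\<lambda>k. norm (X n - X k))"
      by (simp add: dist_norm norm_completion.abs_eq)
    also have "\<dots> \<le> e / 2"
      using completion_rel_lim[OF C]
    proof (rule LIMSEQ_le_const2, intro exI[of _ N] allI impI)
      show "norm (X n - X k) \<le> e / 2" if "N \<le> k" for k
        using N[OF \<open>n \<ge> N\<close> that] by simp
    qed
    finally show ?thesis using \<open>e > 0\<close> by simp
  qed
  then show "\<exists>N. \<forall>n\<ge>N. dist (completion_embed (X n)) (abs_completion X) < e" by blast
qed

lemma completion_dense:
  assumes "e > 0"
  shows "\<exists>x. norm (y - completion_embed x) < e"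
proof -
  obtain X where X: "Cauchy X" "y = abs_completion X"
    using Quotient_abs_rep[OF Quotient_completion, of y] Quotient_rep_reflp[OF Quotient_completion, of y]
    unfolding completion_rel_def by metis
  obtain N where "\<forall>n\<ge>N. dist (completion_embed (X n)) y < e"
    using metric_LIMSEQ_D[OF completion_embed_lim[OF X(1)] assms] unfolding X(2) by blast
  then have "dist (completion_embed (X N)) y < e" by simp
  then show ?thesis by (auto simp: dist_norm norm_minus_commute)
qed

instance completion :: (pre_cstar_algebra) cstar_algebra
proof
  fix Y :: "nat \<Rightarrow> 'a completion" assume Y: "Cauchy Y"
  have "\<forall>n. \<exists>x. norm (Y n - completion_embed x) < inverse (real (Suc n))"
    by (intro allI completion_dense) simp
  then obtain x where x: "\<And>n. norm (Y n - completion_embed (x n)) < inverse (real (Suc n))"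
    by metis
  have z: "(\<lambda>n. Y n - completion_embed (x n)) \<longlonglongrightarrow> 0"
    by (rule Lim_null_comparison[OF _ LIMSEQ_inverse_real_of_nat])
      (intro always_eventually allI less_imp_le x)
  have "Cauchy (\<lambda>n. Y n - (Y n - completion_embed (x n)))"
    by (intro Cauchy_minus Y LIMSEQ_imp_Cauchy[OF z])
  then have "Cauchy (\<lambda>n. completion_embed (x n))" by simp
  then have "Cauchy x" unfolding Cauchy_iff norm_completion_embed .
  from tendsto_add[OF z completion_embed_lim[OF this]] show "convergent Y"
    by (auto simp: convergent_def)
qed


section \<open>The resolvent algebra\<close>

type_synonym 'x resolvent_algebra = "'x resolvent_quot completion"

definition Res :: "real \<Rightarrow> 'x \<Rightarrow> 'x::symplectic_space resolvent_algebra" where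
  "Res l f = completion_embed (abs_resolvent_quot (gen0 l f))"

end

theory Submission
  imports Defs
begin

text \<open>
  Write \<open>A\<^sub>m = R(\<lambda>\<^sub>m, f\<^sub>m) - \<rho>\<^sub>m 1\<close>.  The argument rests on one property of these elements: the ideal
  generated by \<open>A = A\<^sub>m\<close> has a bounded sequential approximate unit \<open>u\<^sub>k = A x\<^sub>k = x\<^sub>k A\<close> that is
  quasi-central, i.e. \<open>[u\<^sub>k, c] \<longlongrightarrow> 0\<close> for every \<open>c\<close> of the resolvent algebra.  Given
  this, the elements \<open>B\<close> with \<open>u\<^sub>k B \<longlongrightarrow> B\<close> form a closed two-sided ideal containing \<open>A\<close>.
  Hence, if \<open>B\<close> lies in the intersection of the ideals, then \<open>B = lim A\<^sub>1 (x\<^sub>k B)\<close>, where \<open>x\<^sub>k B\<close> still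
  lies in the intersection of the remaining ideals.  By induction on the number of factors \<open>B\<close> is in
  the closed linear span of \<open>A\<^sub>1 \<cdots> A\<^sub>n \<R>\<close>, and symmetrically in that of \<open>\<R> A\<^sub>1 \<cdots> A\<^sub>n\<close>;
  the converse inclusions are trivial (\<open>Inter_ideals_eq_product\<close>).

  For \<open>\<rho> = 0\<close> the approximate unit is \<open>i\<nu>R(\<nu>, f)\<close> with \<open>\<nu> \<longlongrightarrow> \<infinity>\<close>; its commutator
  with \<open>R(\<mu>, g)\<close> is \<open>O(1/\<nu>)\<close> by the commutation relation (\<open>quasicentral_unit_Res\<close>).

  For \<open>\<rho> \<noteq> 0\<close> the spectral condition gives \<open>1/\<rho> = i\<lambda> - t\<close> with \<open>t\<close> real.  Heuristically
  \<open>R(\<lambda>, f) = (i\<lambda> - \<phi>(f))\<^sup>-\<^sup>1\<close>, and the approximate unit is \<open>1 - i\<epsilon>D\<close> with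
  \<open>D = (i\<epsilon> + t - \<phi>(f))\<^sup>-\<^sup>1\<close> and \<open>\<epsilon> \<longlongrightarrow> 0\<close>, where \<open>D\<close> is constructed from \<open>R(\<lambda>, f)\<close> by
  Neumann series.  Only its quasi-centrality is not immediate.  If \<open>\<sigma>(f, g) = 0\<close>, then \<open>D\<close> commutes
  with \<open>R(\<mu>, g)\<close>.  Otherwise even \<open>\<epsilon>D R(\<mu>, g)\<close> and \<open>R(\<mu>, g) \<epsilon>D\<close> tend to \<open>0\<close> in norm
  (\<open>resolvent_decay\<close>; this reflects the absolute continuity of the spectrum of \<open>\<phi>(f)\<close>):
  the relation \<open>[D, R(\<mu>, g)] = i\<sigma>(f, g) D R(\<mu>, g)\<^sup>2 D\<close> shows that
  \<open>\<epsilon>\<^sup>2 D R(\<mu>, g)\<^sup>2 D = O(\<epsilon>)\<close> for all \<open>\<mu>\<close>; since \<open>R(\<mu>, g)\<close> is in the closed linear span of the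
  squares of the resolvents of \<open>g\<close> (\<open>in_closed_cspan_squares\<close>), also \<open>\<epsilon>\<^sup>2 D T D \<longlongrightarrow> 0\<close> for
  \<open>T = R(\<mu>, g)\<close> and for \<open>T = R(\<mu>, g) R(\<mu>, g)\<^sup>*\<close>, which is a multiple of \<open>R(- \<mu>, g) - R(\<mu>, g)\<close>; and
  the C*-identity turns the last statement into the claim.
\<close>


section \<open>Closed subspaces and ideals\<close>

lemma closed_cspan_superset: "S \<subseteq> closed_cspan S"
  unfolding closed_cspan_def using closure_subset complex_vector.span_superset by blast

lemma closed_closed_cspan: "closed (closed_cspan S)"
  by (simp add: closed_cspan_def)

lemma csubspace_closure:
  fixes V :: "'a::cstar_algebra set"
  assumes V: "complex_vector.subspace V"
  shows "complex_vector.subspace (closure V)"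
proof (rule complex_vector.subspaceI)
  show "0 \<in> closure V"
    using complex_vector.subspace_0[OF V] closure_subset by blast
  show "x + y \<in> closure V" if "x \<in> closure V" "y \<in> closure V" for x y
  proof -
    obtain f g where f: "\<And>n. f n \<in> V" "f \<longlonglongrightarrow> x" and g: "\<And>n. g n \<in> V" "g \<longlonglongrightarrow> y"
      using \<open>x \<in> closure V\<close> \<open>y \<in> closure V\<close> by (auto simp: closure_sequential)
    have "(\<lambda>n. f n + g n) \<longlonglongrightarrow> x + y" by (intro tendsto_add f g)
    moreover have "f n + g n \<in> V" for n
      using complex_vector.subspace_add[OF V] f g by blast
    ultimately show ?thesis
      unfolding closure_sequential by (intro exI[of _ "\<lambda>n. f n + g n"]) simp
  qed
  show "c *\<^sub>C x \<in> closure V" if "x \<in> closure V" for c x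
  proof -
    have "(*\<^sub>C) c ` V \<subseteq> V" using complex_vector.subspace_scale[OF V] by blast
    then show ?thesis
      using closure_bounded_linear_image_subset[OF bounded_linear_scaleC, of c V]
        closure_mono that by blast
  qed
qed

lemma csubspace_closed_cspan: "complex_vector.subspace (closed_cspan S)"
  unfolding closed_cspan_def by (intro csubspace_closure complex_vector.subspace_span)

lemma closed_cspan_minimal:
  assumes "closed T" "complex_vector.subspace T" "S \<subseteq> T"
  shows "closed_cspan S \<subseteq> T"
  unfolding closed_cspan_def using assms complex_vector.span_minimal closure_minimal by metis

lemma closed_cspan_mult_left:
  assumes "x \<in> closed_cspan S" "\<And>y. y \<in> S \<Longrightarrow> a * y \<in> closed_cspan T"
  shows "a * x \<in> closed_cspan T"
proof -
  have "closed_cspan S \<subseteq> (*) a -` closed_cspan T"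
  proof (rule closed_cspan_minimal)
    show "closed ((*) a -` closed_cspan T)"
      by (intro continuous_closed_vimage closed_closed_cspan) (auto intro: continuous_intros)
    show "complex_vector.subspace ((*) a -` closed_cspan T)"
      using csubspace_closed_cspan[of T]
      by (auto simp: complex_vector.subspace_def distrib_left mult_scaleC_right)
  qed (use assms in auto)
  then show ?thesis using assms by blast
qed

lemma closed_cspan_mult_right:
  assumes "x \<in> closed_cspan S" "\<And>y. y \<in> S \<Longrightarrow> y * a \<in> closed_cspan T"
  shows "x * a \<in> closed_cspan T"
proof -
  have "closed_cspan S \<subseteq> (\<lambda>y. y * a) -` closed_cspan T"
  proof (rule closed_cspan_minimal)
    show "closed ((\<lambda>y. y * a) -` closed_cspan T)"
      by (intro continuous_closed_vimage closed_closed_cspan) (auto intro: continuous_intros)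
    show "complex_vector.subspace ((\<lambda>y. y * a) -` closed_cspan T)"
      using csubspace_closed_cspan[of T]
      by (auto simp: complex_vector.subspace_def distrib_right mult_scaleC_left)
  qed (use assms in auto)
  then show ?thesis using assms by blast
qed

lemma closed_ideal_Inter: "(\<And>T. T \<in> F \<Longrightarrow> closed_ideal T) \<Longrightarrow> closed_ideal (\<Inter>F)"
  unfolding closed_ideal_def by (auto intro!: complex_vector.subspace_Inter)

lemma closed_ideal_ideal_generated: "closed_ideal (ideal_generated S)"
  unfolding ideal_generated_def by (rule hull_in) (auto intro: closed_ideal_Inter)

lemma closed_ideal_mult:
  "closed_ideal I \<Longrightarrow> x \<in> I \<Longrightarrow> a * x \<in> I"
  "closed_ideal I \<Longrightarrow> x \<in> I \<Longrightarrow> x * a \<in> I"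
  by (auto simp: closed_ideal_def)

text \<open>Convergence to \<open>0\<close> along a uniformly bounded sequence of linear maps is a closed condition.\<close>

lemma null_set_closed_csubspace:
  fixes L :: "nat \<Rightarrow> 'a::cstar_algebra \<Rightarrow> 'a"
  assumes add: "\<And>n x y. L n (x + y) = L n x + L n y"
    and scale: "\<And>n c x. L n (c *\<^sub>C x) = c *\<^sub>C L n x"
    and bound: "\<And>n x. norm (L n x) \<le> K * norm x"
  shows "closed {x. (\<lambda>n. L n x) \<longlonglongrightarrow> 0}" "complex_vector.subspace {x. (\<lambda>n. L n x) \<longlonglongrightarrow> 0}"
proof -
  show "complex_vector.subspace {x. (\<lambda>n. L n x) \<longlonglongrightarrow> 0}"
  proof (rule complex_vector.subspaceI)
    show "0 \<in> {x. (\<lambda>n. L n x) \<longlonglongrightarrow> 0}" using scale[of _ 0 0] by simp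
    show "x + y \<in> {x. (\<lambda>n. L n x) \<longlonglongrightarrow> 0}"
      if "x \<in> {x. (\<lambda>n. L n x) \<longlonglongrightarrow> 0}" "y \<in> {x. (\<lambda>n. L n x) \<longlonglongrightarrow> 0}" for x y
      using that by (simp add: add tendsto_add_zero)
    show "c *\<^sub>C x \<in> {x. (\<lambda>n. L n x) \<longlonglongrightarrow> 0}" if "x \<in> {x. (\<lambda>n. L n x) \<longlonglongrightarrow> 0}" for c x
      using that bounded_linear.tendsto_zero[OF bounded_linear_scaleC] by (simp add: scale)
  qed
  have minus: "L n (x - y) = L n x - L n y" for n x y
    using add[of n "x - y" y] by simp
  show "closed {x. (\<lambda>n. L n x) \<longlonglongrightarrow> 0}"
    unfolding closed_sequential_limits
  proof (intro allI impI, elim conjE)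
    fix X x assume X: "\<forall>k. X k \<in> {x. (\<lambda>n. L n x) \<longlonglongrightarrow> 0}" "X \<longlonglongrightarrow> x"
    have "(\<lambda>n. L n x) \<longlonglongrightarrow> 0"
    proof (rule LIMSEQ_I)
      fix e :: real assume "e > 0"
      define M where "M = \<bar>K\<bar> + 1"
      have M: "M > 0" "\<And>n x. norm (L n x) \<le> M * norm x"
      proof -
        show "M > 0" by (simp add: M_def)
        show "norm (L n x) \<le> M * norm x" for n x
          using bound[of n x] mult_right_mono[of K M "norm x"] abs_ge_self[of K]
          by (simp add: M_def)
      qed
      obtain k where k: "norm (X k - x) < e / 2 / M"
        using LIMSEQ_D[OF X(2), of "e / 2 / M"] M \<open>e > 0\<close> by fastforce
      obtain N where N: "\<And>n. n \<ge> N \<Longrightarrow> norm (L n (X k)) < e / 2"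
        using LIMSEQ_D[of "\<lambda>n. L n (X k)" 0 "e / 2"] X(1) \<open>e > 0\<close> by auto
      have "norm (L n x - 0) < e" if "n \<ge> N" for n
      proof -
        have "norm (L n (X k - x)) < e / 2"
          using M(2)[of n "X k - x"] k M(1) by (simp add: field_simps)
        then have "norm (L n (X k) - L n x) < e / 2" by (simp add: minus)
        moreover have "norm (L n x) \<le> norm (L n (X k)) + norm (L n (X k) - L n x)"
          using norm_triangle_ineq4[of "L n (X k)" "L n (X k) - L n x"] by simp
        ultimately show ?thesis using N[OF that] by simp
      qed
      then show "\<exists>N. \<forall>n\<ge>N. norm (L n x - 0) < e" by blast
    qed
    then show "x \<in> {x. (\<lambda>n. L n x) \<longlonglongrightarrow> 0}" by simp
  qed
qed


section \<open>Quasi-central approximate units and products of ideals\<close>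

text \<open>
  A bounded sequence \<open>u\<close> in \<open>A \<R> \<inter> \<R> A\<close> that acts on \<open>A\<close> as an approximate unit and commutes
  asymptotically with all elements.  The factor \<open>x\<close> is the same on both sides of \<open>A\<close>.
\<close>

definition quasicentral_unit :: "'a::cstar_algebra \<Rightarrow> (nat \<Rightarrow> 'a) \<Rightarrow> bool" where
  "quasicentral_unit A u \<longleftrightarrow>
     (\<forall>n. \<exists>x. u n = A * x \<and> u n = x * A) \<and> Bseq u \<and>
     (\<lambda>n. u n * A) \<longlonglongrightarrow> A \<and> (\<forall>c. (\<lambda>n. u n * c - c * u n) \<longlonglongrightarrow> 0)"

lemma quasicentral_unit_ideal:
  assumes u: "quasicentral_unit A u" and B: "B \<in> ideal_generated {A}"
  shows "(\<lambda>n. u n * B) \<longlonglongrightarrow> B" "(\<lambda>n. B * u n) \<longlonglongrightarrow> B"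
proof -
  obtain K where K: "\<And>n. norm (u n) \<le> K"
    using u unfolding quasicentral_unit_def Bseq_def by blast
  define J where "J = {x. (\<lambda>n. u n * x - x) \<longlonglongrightarrow> 0}"
  have bound: "norm (u n * x - x) \<le> (K + 1) * norm x" for n x
  proof -
    have "norm (u n * x - x) \<le> norm (u n) * norm x + norm x"
      by (rule order_trans[OF norm_triangle_ineq4]) (simp add: norm_mult_ineq)
    also have "\<dots> \<le> K * norm x + norm x"
      using K[of n] by (simp add: mult_right_mono)
    finally show ?thesis by (simp add: algebra_simps)
  qed
  have "closed_ideal J"
    unfolding closed_ideal_def
  proof (intro conjI ballI allI)
    note * = null_set_closed_csubspace[of "\<lambda>n x. u n * x - x", OF _ _ bound]
    show "closed J" unfolding J_def
      by (rule *(1)) (simp_all add: algebra_simps mult_scaleC_right)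
    show "complex_vector.subspace J" unfolding J_def
      by (rule *(2)) (simp_all add: algebra_simps mult_scaleC_right)
    fix a b assume "a \<in> J"
    then have a: "(\<lambda>n. u n * a - a) \<longlonglongrightarrow> 0" by (simp add: J_def)
    have "(\<lambda>n. (u n * b - b * u n) * a + b * (u n * a - a)) \<longlonglongrightarrow> 0"
      using u a by (auto simp: quasicentral_unit_def
          intro!: tendsto_add_zero tendsto_mult_left_zero tendsto_mult_right_zero)
    then show "b * a \<in> J" by (simp add: J_def algebra_simps)
    show "a * b \<in> J"
      using tendsto_mult_left_zero[OF a, of b] by (simp add: J_def algebra_simps)
  qed
  moreover have "A \<in> J"
    using u by (simp add: J_def quasicentral_unit_def LIM_zero)
  ultimately have "B \<in> J"
    using B hull_minimal[of "{A}" J closed_ideal] by (auto simp: ideal_generated_def)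
  then show l: "(\<lambda>n. u n * B) \<longlonglongrightarrow> B" by (simp add: J_def LIM_zero_iff)
  have "(\<lambda>n. u n * B - (u n * B - B * u n)) \<longlonglongrightarrow> B - 0"
    using u by (intro tendsto_diff l) (simp add: quasicentral_unit_def)
  then show "(\<lambda>n. B * u n) \<longlonglongrightarrow> B" by simp
qed

text \<open>
  An element \<open>B\<close> of all the ideals is the limit of \<open>A\<^sub>m x\<^sub>n B\<close> for the first index \<open>m\<close>, and \<open>x\<^sub>n B\<close> is
  in all the other ideals; the induction hypothesis applies to it.
\<close>

lemma Inter_ideals_left:
  fixes A :: "nat \<Rightarrow> 'a::cstar_algebra"
  assumes "\<And>m. m \<in> set ms \<Longrightarrow> quasicentral_unit (A m) (u m)"
    and "B \<in> (\<Inter>m\<in>set ms. ideal_generated {A m})"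
  shows "B \<in> closed_cspan {(\<Prod>m\<leftarrow>ms. A m) * b | b. True}"
  using assms
proof (induction ms arbitrary: B)
  case Nil
  show ?case by (rule subsetD[OF closed_cspan_superset]) auto
next
  case (Cons m ms)
  let ?P = "\<Prod>m\<leftarrow>ms. A m"
  have u: "quasicentral_unit (A m) (u m)" using Cons.prems by simp
  then obtain x where x: "\<And>n. u m n = A m * x n"
    unfolding quasicentral_unit_def by metis
  have "u m n * B \<in> closed_cspan {(\<Prod>m\<leftarrow>m # ms. A m) * b | b. True}" for n
  proof -
    have "x n * B \<in> (\<Inter>m\<in>set ms. ideal_generated {A m})"
      using Cons.prems(2) by (auto intro: closed_ideal_mult closed_ideal_ideal_generated)
    then have "x n * B \<in> closed_cspan {?P * b | b. True}"
      using Cons.IH Cons.prems(1) by simp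
    then have "A m * (x n * B) \<in> closed_cspan {(\<Prod>m\<leftarrow>m # ms. A m) * b | b. True}"
      by (rule closed_cspan_mult_left)
        (auto simp: mult.assoc intro!: subsetD[OF closed_cspan_superset])
    then show ?thesis by (simp add: x mult.assoc)
  qed
  moreover have "(\<lambda>n. u m n * B) \<longlonglongrightarrow> B"
    using quasicentral_unit_ideal[OF u] Cons.prems by simp
  ultimately show ?case
    by (rule closed_sequentially[OF closed_closed_cspan])
qed

lemma Inter_ideals_right:
  fixes A :: "nat \<Rightarrow> 'a::cstar_algebra"
  assumes "\<And>m. m \<in> set ms \<Longrightarrow> quasicentral_unit (A m) (u m)"
    and "B \<in> (\<Inter>m\<in>set ms. ideal_generated {A m})"
  shows "B \<in> closed_cspan {a * (\<Prod>m\<leftarrow>ms. A m) | a. True}"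
  using assms
proof (induction ms arbitrary: B rule: rev_induct)
  case Nil
  show ?case by (rule subsetD[OF closed_cspan_superset]) auto
next
  case (snoc m ms)
  let ?P = "\<Prod>m\<leftarrow>ms. A m"
  have u: "quasicentral_unit (A m) (u m)" using snoc.prems by simp
  then obtain x where x: "\<And>n. u m n = x n * A m"
    unfolding quasicentral_unit_def by metis
  have "B * u m n \<in> closed_cspan {a * (\<Prod>m\<leftarrow>ms @ [m]. A m) | a. True}" for n
  proof -
    have "B * x n \<in> (\<Inter>m\<in>set ms. ideal_generated {A m})"
      using snoc.prems(2) by (auto intro: closed_ideal_mult closed_ideal_ideal_generated)
    then have "B * x n \<in> closed_cspan {a * ?P | a. True}"
      using snoc.IH snoc.prems(1) by simp
    then have "(B * x n) * A m \<in> closed_cspan {a * (\<Prod>m\<leftarrow>ms @ [m]. A m) | a. True}"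
      by (rule closed_cspan_mult_right)
        (auto simp: mult.assoc intro!: subsetD[OF closed_cspan_superset])
    then show ?thesis by (simp add: x mult.assoc)
  qed
  moreover have "(\<lambda>n. B * u m n) \<longlonglongrightarrow> B"
    using quasicentral_unit_ideal[OF u] snoc.prems by simp
  ultimately show ?case
    by (rule closed_sequentially[OF closed_closed_cspan])
qed

lemma closed_ideal_prod_list:
  assumes "closed_ideal I" "m \<in> set ms" "A m \<in> I"
  shows "(\<Prod>m\<leftarrow>ms. A m) \<in> I"
  using assms(2) by (induction ms) (use assms closed_ideal_mult in auto)

lemma closed_cspan_subset_closed_ideal:
  assumes "closed_ideal I" "S \<subseteq> I"
  shows "closed_cspan S \<subseteq> I"
  using assms closed_cspan_minimal by (auto simp: closed_ideal_def)

lemma Inter_ideals_eq_product: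
  fixes A :: "nat \<Rightarrow> 'a::cstar_algebra"
  assumes "\<And>m. m \<in> set ms \<Longrightarrow> \<exists>u. quasicentral_unit (A m) u"
  defines "I \<equiv> (\<Inter>m\<in>set ms. ideal_generated {A m})" and "P \<equiv> (\<Prod>m\<leftarrow>ms. A m)"
  shows "I = closed_cspan {a * P * b | a b. True}"
    and "I = closed_cspan {P * b | b. True}"
    and "I = closed_cspan {a * P | a. True}"
proof -
  obtain u where u: "\<And>m. m \<in> set ms \<Longrightarrow> quasicentral_unit (A m) (u m)"
    using assms(1) by metis
  have I: "closed_ideal I"
    unfolding I_def by (rule closed_ideal_Inter) (auto intro: closed_ideal_ideal_generated)
  have "P \<in> ideal_generated {A m}" if "m \<in> set ms" for m
    unfolding P_def ideal_generated_def
    by (rule closed_ideal_prod_list[OF closed_ideal_ideal_generated[unfolded ideal_generated_def] that])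
      (simp add: hull_inc)
  then have P: "P \<in> I" by (simp add: I_def)
  have l: "I \<subseteq> closed_cspan {P * b | b. True}"
    using Inter_ideals_left[OF u] by (auto simp: I_def P_def)
  have r: "I \<subseteq> closed_cspan {a * P | a. True}"
    using Inter_ideals_right[OF u] by (auto simp: I_def P_def)
  have b: "closed_cspan {P * b | b. True} \<subseteq> closed_cspan {a * P * b | a b. True}"
    unfolding closed_cspan_def
    by (intro closure_mono complex_vector.span_mono) (auto, metis mult_1)
  have "closed_cspan {a * P * b | a b. True} \<subseteq> I" "closed_cspan {P * b | b. True} \<subseteq> I"
    "closed_cspan {a * P | a. True} \<subseteq> I"
    by (rule closed_cspan_subset_closed_ideal[OF I]; use P closed_ideal_mult[OF I] in auto)+
  with l r b show "I = closed_cspan {a * P * b | a b. True}"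
    "I = closed_cspan {P * b | b. True}" "I = closed_cspan {a * P | a. True}" by auto
qed


section \<open>Families of resolvents\<close>

lemma inverse_of_one_minus:
  fixes x :: "'a::cstar_algebra"
  assumes "norm x < 1"
  shows "\<exists>W. W * (1 - x) = 1 \<and> (1 - x) * W = 1"
proof (intro exI conjI)
  have s: "summable (\<lambda>n. x ^ n)" by (rule complete_algebra_summable_geometric[OF assms])
  have tail: "(\<Sum>n. x ^ n) = 1 + (\<Sum>n. x ^ Suc n)"
    using suminf_split_head[OF s] by simp
  show "(\<Sum>n. x ^ n) * (1 - x) = 1"
    using suminf_mult2[OF s, of x] tail by (simp add: right_diff_distrib power_commutes)
  show "(1 - x) * (\<Sum>n. x ^ n) = 1"
    using suminf_mult[OF s, of x] tail by (simp add: left_diff_distrib)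
qed

lemma norm_le_inverse:
  fixes x :: "'a::cstar_algebra"
  assumes "c *\<^sub>C (star x * x) = star x - x"
  shows "cmod c * norm x \<le> 2"
proof (cases "norm x = 0")
  case False
  have "cmod c * (norm x)\<^sup>2 = norm (star x - x)"
    by (simp add: assms[symmetric] norm_scaleC cstar_identity)
  also have "\<dots> \<le> norm x + norm x"
    using norm_triangle_ineq4[of "star x" x] by (simp add: norm_star)
  finally have "(cmod c * norm x) * norm x \<le> 2 * norm x"
    by (simp add: power2_eq_square mult.assoc)
  then show ?thesis using False by simp
qed simp

text \<open>
  The elements \<open>R l\<close> behave like \<open>(il - H)\<^sup>-\<^sup>1\<close> for a self-adjoint \<open>H\<close>, at the points \<open>il\<close> of the
  imaginary axis without \<open>0\<close>; the value \<open>R 0\<close> is irrelevant.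
\<close>

locale resolvent_family =
  fixes R :: "real \<Rightarrow> 'a::cstar_algebra"
  assumes resolvent_eq: "l \<noteq> 0 \<Longrightarrow> m \<noteq> 0 \<Longrightarrow> R l - R m = (\<i> * of_real (m - l)) *\<^sub>C (R l * R m)"
    and star_R: "l \<noteq> 0 \<Longrightarrow> star (R l) = R (- l)"
begin

lemma commute:
  assumes "l \<noteq> 0" "m \<noteq> 0"
  shows "R l * R m = R m * R l"
proof (cases "l = m")
  case False
  have "(\<i> * of_real (m - l)) *\<^sub>C (R l * R m) = - (R m - R l)"
    using resolvent_eq[OF assms] by simp
  also have "\<dots> = (\<i> * of_real (m - l)) *\<^sub>C (R m * R l)"
    unfolding resolvent_eq[OF assms(2,1)] complex_vector.scale_minus_left[symmetric]
    by (simp add: algebra_simps)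
  finally show ?thesis
    using False by (simp add: complex_vector.scale_cancel_left)
qed simp

lemma star_mult_self:
  assumes "l \<noteq> 0"
  shows "(2 * \<i> * of_real l) *\<^sub>C (R l * star (R l)) = star (R l) - R l"
    and "(2 * \<i> * of_real l) *\<^sub>C (star (R l) * R l) = star (R l) - R l"
  using resolvent_eq[of "- l" l] commute[of l "- l"] assms by (simp_all add: star_R)

lemma norm_le:
  assumes "l \<noteq> 0"
  shows "norm (R l) \<le> 1 / \<bar>l\<bar>"
proof -
  from norm_le_inverse[OF star_mult_self(2)[OF assms]] assms show ?thesis
    by (simp add: norm_mult field_simps)
qed

text \<open>
  Formally \<open>1 - i(l - z)R l = (iz - H)(il - H)\<^sup>-\<^sup>1\<close>, so its inverse is what is needed for a resolvent
  at the spectral parameter \<open>iz\<close>.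
  The bound \<open>\<parallel>R l\<parallel> \<le> 1 / \<bar>l\<bar>\<close> lets the Neumann series for the resolvent at \<open>z\<close> converge in a disc
  around \<open>l\<close> of radius \<open>\<bar>l\<bar>\<close>, and these discs cover the plane without the imaginary axis.
  The resolvent equation then moves the base point of the series to the given \<open>l\<close>.
\<close>

lemma inverse_exists:
  assumes z: "Re z \<noteq> 0" and l: "l \<noteq> 0"
  shows "\<exists>W. W * (1 - (\<i> * (of_real l - z)) *\<^sub>C R l) = 1 \<and> (1 - (\<i> * (of_real l - z)) *\<^sub>C R l) * W = 1"
proof -
  \<comment> \<open>With this \<open>m\<close> the point \<open>z\<close> satisfies \<open>\<bar>m - z\<bar>\<^sup>2 = m\<^sup>2 - \<bar>z\<bar>\<^sup>2\<close>, so it is in the disc around \<open>m\<close>.\<close>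
  define m where "m = (cmod z)\<^sup>2 / Re z"
  then have m: "m \<noteq> 0" "m * Re z = (cmod z)\<^sup>2" "z \<noteq> 0" using z by (auto simp: m_def)
  have "(cmod (of_real m - z))\<^sup>2 = m\<^sup>2 - 2 * (m * Re z) + (cmod z)\<^sup>2"
    by (simp add: cmod_power2 power2_diff)
  also have "\<dots> < \<bar>m\<bar>\<^sup>2" using m z by simp
  finally have near: "cmod (of_real m - z) < \<bar>m\<bar>"
    by (rule power_less_imp_less_base) simp
  have "norm ((\<i> * (of_real m - z)) *\<^sub>C R m) \<le> cmod (of_real m - z) * (1 / \<bar>m\<bar>)"
    by (simp only: norm_scaleC norm_mult norm_ii mult_1) (intro mult_left_mono norm_le m norm_ge_zero)
  also have "\<dots> < 1" using near m by simp
  finally obtain V where V: "V * (1 - (\<i> * (of_real m - z)) *\<^sub>C R m) = 1"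
      "(1 - (\<i> * (of_real m - z)) *\<^sub>C R m) * V = 1"
    using inverse_of_one_minus by blast
  define d e where "d = \<i> * of_real (l - m)" and "e = \<i> * (of_real m - z)"
  let ?a = "1 - d *\<^sub>C R l" and ?b = "1 + d *\<^sub>C R m"
  have key: "d *\<^sub>C (R m * R l) = R m - R l" "d *\<^sub>C (R l * R m) = R m - R l"
    using resolvent_eq[OF m(1) l] commute[OF m(1) l] by (simp_all add: d_def)
  have de: "\<i> * (of_real l - z) = d + e"
    by (simp add: d_def e_def algebra_simps)
  have ba: "?b * ?a = 1" "?a * ?b = 1"
    by (simp_all add: key algebra_simps mult_scaleC_left mult_scaleC_right)
  have eq: "1 - (d + e) *\<^sub>C R l = ?a * (1 - e *\<^sub>C R m)"
  proof -
    have "?a * (1 - e *\<^sub>C R m) = 1 - e *\<^sub>C R m - d *\<^sub>C R l + e *\<^sub>C d *\<^sub>C (R l * R m)"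
      by (simp add: algebra_simps mult_scaleC_left mult_scaleC_right scaleC_scaleC)
    also have "\<dots> = 1 - (d + e) *\<^sub>C R l"
      by (simp add: key algebra_simps scaleC_add_left)
    finally show ?thesis by simp
  qed
  note V' = V[folded e_def]
  have "V * ?b * (?a * (1 - e *\<^sub>C R m)) = 1"
    using V' ba by (metis mult.assoc mult_1)
  moreover have "?a * (1 - e *\<^sub>C R m) * (V * ?b) = 1"
    using V' ba by (metis mult.assoc mult_1)
  ultimately show ?thesis unfolding de eq by blast
qed

text \<open>
  Here \<open>D\<close> stands for \<open>(iz - H)\<^sup>-\<^sup>1\<close>.  The equations for \<open>star D\<close> express that \<open>H\<close> is
  self-adjoint; they give the norm bound.
\<close>

lemma complex_resolvent:
  assumes z: "Re z \<noteq> 0" and l: "l \<noteq> 0"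
  obtains D W where "W * (1 - (\<i> * (of_real l - z)) *\<^sub>C R l) = 1"
    "(1 - (\<i> * (of_real l - z)) *\<^sub>C R l) * W = 1"
    "(1 - (\<i> * (of_real l - z)) *\<^sub>C R l) * D = R l"
    "D * (1 - (\<i> * (of_real l - z)) *\<^sub>C R l) = R l"
    "(2 * \<i> * of_real (Re z)) *\<^sub>C (star D * D) = star D - D"
    "(2 * \<i> * of_real (Re z)) *\<^sub>C (D * star D) = star D - D"
    "norm D \<le> 1 / \<bar>Re z\<bar>"
proof -
  define c where "c = \<i> * (of_real l - z)"
  define k where "k = 2 * \<i> * of_real (Re z)"
  define x where "x = 1 - c *\<^sub>C R l"
  obtain W where W: "W * x = 1" "x * W = 1"
    using inverse_exists[OF assms] unfolding x_def c_def by blast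
  define D where "D = R l * W"
  have xR: "x * R l = R l * x"
    by (simp add: x_def algebra_simps mult_scaleC_left mult_scaleC_right)
  have D: "x * D = R l" "D * x = R l"
    using W by (simp_all add: D_def mult.assoc flip: xR) (simp add: xR W flip: mult.assoc, simp add: W mult.assoc)
  have D': "star D * star x = star (R l)" "star x * star D = star (R l)"
    using D by (simp_all flip: star_mult)
  have W': "star x * star W = 1" "star W * star x = 1"
    using W by (simp_all flip: star_mult)
  have sx: "star x = 1 - cnj c *\<^sub>C star (R l)"
    by (simp add: x_def star_diff star_scaleC)
  have ck: "c - cnj c + k = 2 * \<i> * of_real l"
    by (simp add: c_def k_def complex_eq_iff)
  then have split: "k *\<^sub>C y = (2 * \<i> * of_real l) *\<^sub>C y - c *\<^sub>C y + cnj c *\<^sub>C y" for y :: 'a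
    by (simp add: complex_vector.scale_left_diff_distrib scaleC_add_left flip: ck)
  \<comment> \<open>Multiplying by the invertible \<open>star x\<close> and \<open>x\<close> reduces the equations for \<open>D\<close> to those for \<open>R l\<close>.\<close>
  have "star x * (k *\<^sub>C (star D * D)) * x = k *\<^sub>C ((star x * star D) * (D * x))"
    by (simp add: mult.assoc mult_scaleC_left mult_scaleC_right)
  also have "\<dots> = star (R l) * x - star x * R l"
    by (simp add: D D' split star_mult_self(2)[OF l])
      (simp add: x_def sx algebra_simps mult_scaleC_left mult_scaleC_right star_diff star_scaleC)
  also have "\<dots> = (star x * star D) * x - star x * (D * x)"
    by (simp add: D D')
  also have "\<dots> = star x * (star D - D) * x"
    by (simp add: algebra_simps)
  finally have "star W * (star x * (k *\<^sub>C (star D * D)) * x) * W = star W * (star x * (star D - D) * x) * W"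
    by simp
  then have 1: "k *\<^sub>C (star D * D) = star D - D"
    using W W' by (metis (no_types, lifting) mult.assoc mult.right_neutral mult_1)
  have "x * (k *\<^sub>C (D * star D)) * star x = k *\<^sub>C ((x * D) * (star D * star x))"
    by (simp add: mult.assoc mult_scaleC_left mult_scaleC_right)
  also have "\<dots> = x * star (R l) - R l * star x"
    by (simp add: D D' split star_mult_self(1)[OF l])
      (simp add: x_def sx algebra_simps mult_scaleC_left mult_scaleC_right star_diff star_scaleC)
  also have "\<dots> = x * (star D * star x) - (x * D) * star x"
    by (simp add: D D')
  also have "\<dots> = x * (star D - D) * star x"
    by (simp add: algebra_simps)
  finally have "W * (x * (k *\<^sub>C (D * star D)) * star x) * star W = W * (x * (star D - D) * star x) * star W"
    by simp
  then have 2: "k *\<^sub>C (D * star D) = star D - D"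
    using W W' by (metis (no_types, lifting) mult.assoc mult.right_neutral mult_1)
  have "norm D \<le> 1 / \<bar>Re z\<bar>"
    using norm_le_inverse[OF 1] z by (simp add: k_def norm_mult field_simps)
  with W D 1 2 show thesis
    unfolding x_def c_def k_def by (rule that)
qed

text \<open>
  A discrete form of \<open>R l = \<integral> i (R s)\<^sup>2 ds\<close>, integrated over the ray from \<open>l\<close> away from \<open>0\<close>:
  Riemann sums with \<open>p\<^sup>3\<close> steps of length \<open>\<bar>l\<bar> / p\<^sup>2\<close> leave a remainder of order \<open>1 / p\<close> both from the
  discretization and from the truncation at \<open>l (1 + p)\<close>.
\<close>

lemma in_closed_cspan_squares:
  assumes l: "l \<noteq> 0"
  shows "R l \<in> closed_cspan {R s * R s | s. s \<noteq> 0}"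
proof -
  define p where "p m = real (Suc m)" for m
  have p: "p m > 0" for m by (simp add: p_def)
  define s where "s m k = l * (1 + real k / (p m)\<^sup>2)" for m k
  define h where "h m = l / (p m)\<^sup>2" for m
  define N where "N m = Suc m ^ 3" for m
  define Y where "Y m = (\<Sum>k<N m. (\<i> * of_real (h m)) *\<^sub>C (R (s m k) * R (s m k)))" for m
  have N: "real (N m) = p m ^ 3" for m by (simp only: N_def p_def of_nat_power)
  have s0: "s m 0 = l" "s m (Suc k) - s m k = h m" for m k
    by (simp_all add: s_def h_def algebra_simps add_divide_distrib)
  have s_ge: "\<bar>s m k\<bar> \<ge> \<bar>l\<bar>" "s m k \<noteq> 0" for m k
  proof -
    have "\<bar>s m k\<bar> = \<bar>l\<bar> * (1 + real k / (p m)\<^sup>2)"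
      by (simp add: s_def abs_mult)
    also have "\<dots> \<ge> \<bar>l\<bar> * 1" by (intro mult_left_mono) auto
    finally show "\<bar>s m k\<bar> \<ge> \<bar>l\<bar>" by simp
    then show "s m k \<noteq> 0" using l by auto
  qed
  have R_le: "norm (R (s m k)) \<le> 1 / \<bar>l\<bar>" for m k
    by (rule order_trans[OF norm_le[OF s_ge(2)] frac_le]) (use s_ge(1) l in auto)
  have step: "norm (R (s m k) - R (s m (Suc k)) - (\<i> * of_real (h m)) *\<^sub>C (R (s m k) * R (s m k)))
      \<le> (h m)\<^sup>2 / \<bar>l\<bar> ^ 3" for m k
  proof -
    let ?a = "R (s m k)" and ?b = "R (s m (Suc k))" and ?c = "\<i> * complex_of_real (h m)"
    have d: "?a - ?b = ?c *\<^sub>C (?a * ?b)"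
      using resolvent_eq[OF s_ge(2) s_ge(2), of m k m "Suc k"] by (simp add: s0)
    have "?a - ?b - ?c *\<^sub>C (?a * ?a) = - (?c *\<^sub>C (?a * (?a - ?b)))"
      unfolding right_diff_distrib complex_vector.scale_right_diff_distrib d[symmetric] by simp
    also have "\<dots> = - (?c *\<^sub>C (?a * (?c *\<^sub>C (?a * ?b))))" unfolding d ..
    finally have "norm (?a - ?b - ?c *\<^sub>C (?a * ?a)) = (h m)\<^sup>2 * norm (?a * (?a * ?b))"
      by (simp add: norm_scaleC mult_scaleC_right norm_mult power2_eq_square)
    also have "norm (?a * (?a * ?b)) \<le> norm ?a * (norm ?a * norm ?b)"
      by (meson mult_left_mono norm_ge_zero norm_mult_ineq order_trans)
    also have "\<dots> \<le> 1 / \<bar>l\<bar> * (1 / \<bar>l\<bar> * (1 / \<bar>l\<bar>))"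
      by (intro mult_mono R_le) auto
    finally show ?thesis
      by (simp add: mult_left_mono power3_eq_cube mult.assoc)
  qed
  have err: "norm (R l - Y m) \<le> 2 / \<bar>l\<bar> * inverse (p m)" for m
  proof -
    have "R l - R (s m (N m)) = (\<Sum>k<N m. R (s m k) - R (s m (Suc k)))"
      using sum_lessThan_telescope'[of "\<lambda>k. R (s m k)" "N m"] by (simp add: s0)
    then have "R l - Y m = R (s m (N m)) +
        (\<Sum>k<N m. R (s m k) - R (s m (Suc k)) - (\<i> * of_real (h m)) *\<^sub>C (R (s m k) * R (s m k)))"
      unfolding Y_def sum_subtractf by (simp add: algebra_simps)
    also have "norm \<dots> \<le> norm (R (s m (N m))) + real (N m) * ((h m)\<^sup>2 / \<bar>l\<bar> ^ 3)"
      using sum_norm_bound[of "{..<N m}", OF step]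
      by (intro order_trans[OF norm_triangle_ineq] add_left_mono) simp
    also have "real (N m) * ((h m)\<^sup>2 / \<bar>l\<bar> ^ 3) = inverse (p m) / \<bar>l\<bar>"
    proof -
      have "l\<^sup>2 = \<bar>l\<bar>\<^sup>2" by simp
      then have "real (N m) * ((h m)\<^sup>2 / \<bar>l\<bar> ^ 3) = (p m) ^ 3 * (\<bar>l\<bar>\<^sup>2 / (p m) ^ 4 / \<bar>l\<bar> ^ 3)"
        unfolding N h_def by (simp only: power_divide power_mult[symmetric] numeral_times_numeral arith_simps)
      also have "\<dots> = inverse (p m) / \<bar>l\<bar>"
        using p[of m] l by (simp add: divide_simps eval_nat_numeral)
      finally show ?thesis .
    qed
    also have "norm (R (s m (N m))) \<le> inverse (p m) / \<bar>l\<bar>"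
    proof -
      have "s m (N m) = l * (1 + p m)"
        using p[of m] by (simp add: s_def N power2_eq_square power3_eq_cube)
      then have "\<bar>s m (N m)\<bar> \<ge> \<bar>l\<bar> * p m"
        using p[of m] by (simp add: abs_mult mult_left_mono)
      then have "1 / \<bar>s m (N m)\<bar> \<le> 1 / (\<bar>l\<bar> * p m)"
        using l p[of m] by (intro divide_left_mono) (auto intro!: mult_pos_pos simp: s_ge)
      then show ?thesis
        using norm_le[OF s_ge(2), of m "N m"] by (simp add: field_simps)
    qed
    finally show ?thesis by simp
  qed
  have "(\<lambda>m. 2 / \<bar>l\<bar> * inverse (p m)) \<longlonglongrightarrow> 0"
    unfolding p_def by (intro tendsto_mult_right_zero LIMSEQ_inverse_real_of_nat)
  then have "(\<lambda>m. R l - Y m) \<longlonglongrightarrow> 0"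
    by (rule Lim_null_comparison[rotated]) (intro always_eventually allI err)
  from tendsto_diff[OF tendsto_const[of "R l"] this] have lim: "Y \<longlonglongrightarrow> R l" by simp
  have "Y m \<in> complex_vector.span {R s * R s | s. s \<noteq> 0}" for m
    unfolding Y_def
    by (intro complex_vector.span_sum complex_vector.span_scale complex_vector.span_base)
      (use s_ge in blast)
  then show ?thesis
    unfolding closed_cspan_def closure_sequential using lim by (intro exI[of _ Y]) simp
qed

end


section \<open>The resolvent algebra\<close>

text \<open>The canonical *-homomorphism of \<open>\<R>\<^sub>0\<close> onto a dense subalgebra of the resolvent algebra.\<close>

definition resolvent_hom :: "'x::symplectic_space resolvent_alg0 \<Rightarrow> 'x resolvent_algebra" where
  "resolvent_hom a = completion_embed (abs_resolvent_quot a)"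

lemma completion_embed_hom:
  "completion_embed (x + y) = completion_embed x + completion_embed y"
  "completion_embed (x - y) = completion_embed x - completion_embed y"
  "completion_embed (x * y) = completion_embed x * completion_embed y"
  "completion_embed (c *\<^sub>C x) = c *\<^sub>C completion_embed x"
  "completion_embed (star x) = star (completion_embed x)"
  "completion_embed 1 = 1" "completion_embed 0 = 0"
  by (transfer, simp add: completion_rel_refl Cauchy_const')+

lemma resolvent_hom:
  "resolvent_hom (x + y) = resolvent_hom x + resolvent_hom y"
  "resolvent_hom (x - y) = resolvent_hom x - resolvent_hom y"
  "resolvent_hom (x * y) = resolvent_hom x * resolvent_hom y"
  "resolvent_hom (c *\<^sub>C x) = c *\<^sub>C resolvent_hom x"
  "resolvent_hom (star x) = star (resolvent_hom x)"
  "resolvent_hom 1 = 1" "resolvent_hom 0 = 0"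
  unfolding resolvent_hom_def completion_embed_hom[symmetric]
    plus_resolvent_quot.abs_eq minus_resolvent_quot.abs_eq times_resolvent_quot.abs_eq
    scaleC_resolvent_quot.abs_eq star_resolvent_quot.abs_eq one_resolvent_quot_def
    zero_resolvent_quot_def
  by simp_all

lemma Res_eq_hom: "Res l f = resolvent_hom (gen0 l f)"
  by (simp add: Res_def resolvent_hom_def)

lemma gen0_relations:
  fixes f g :: "'x::symplectic_space"
  shows "gen0 0 f = 0"
    and "l \<noteq> 0 \<Longrightarrow> star (gen0 l f) = gen0 (- l) f"
    and "l \<noteq> 0 \<Longrightarrow> m \<noteq> 0 \<Longrightarrow>
      gen0 l f - gen0 m f = (\<i> * of_real (m - l)) *\<^sub>C (gen0 l f * gen0 m f)"
    and "l \<noteq> 0 \<Longrightarrow> m \<noteq> 0 \<Longrightarrow> gen0 l f * gen0 m g - gen0 m g * gen0 l f =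
      (\<i> * of_real (sform f g)) *\<^sub>C (gen0 l f * (gen0 m g * gen0 m g) * gen0 l f)"
  unfolding minus_resolvent_alg0_def uminus_resolvent_alg0_def
  by (transfer; blast intro: resolvent_rel.intros)+

lemma resolvent_family_Res: "resolvent_family (\<lambda>l. Res l f)"
  unfolding Res_eq_hom
  by (rule resolvent_family.intro) (simp_all add: gen0_relations flip: resolvent_hom)

lemma Res_commutator:
  assumes "l \<noteq> 0" "m \<noteq> 0"
  shows "Res l f * Res m g - Res m g * Res l f =
    (\<i> * of_real (sform f g)) *\<^sub>C (Res l f * (Res m g * Res m g) * Res l f)"
  using assms by (simp add: Res_eq_hom gen0_relations flip: resolvent_hom)

text \<open>
  The star need not be mentioned among the closure properties of \<open>C\<close>, since the set of generators is
  invariant under it; the induction over terms treats each element together with its adjoint.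
\<close>

lemma resolvent_algebra_generated:
  fixes C :: "'x::symplectic_space resolvent_algebra set"
  assumes "closed C" "complex_vector.subspace C" and one: "1 \<in> C"
    and mult: "\<And>a b. a \<in> C \<Longrightarrow> b \<in> C \<Longrightarrow> a * b \<in> C"
    and Res: "\<And>m g. m \<noteq> 0 \<Longrightarrow> Res m g \<in> C"
  shows "C = UNIV"
proof -
  note sub = complex_vector.subspace_0[OF assms(2)] complex_vector.subspace_add[OF assms(2)]
    complex_vector.subspace_scale[OF assms(2)]
  have "resolvent_hom (abs_resolvent_alg0 t) \<in> C \<and> star (resolvent_hom (abs_resolvent_alg0 t)) \<in> C"
    for t :: "'x rterm"
  proof (induction t)
    case (Gen m g)
    have "resolvent_hom (gen0 m g) \<in> C \<and> star (resolvent_hom (gen0 m g)) \<in> C"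
    proof (cases "m = 0")
      case True
      then show ?thesis
        using gen0_relations(1)[of g] sub(1) by (simp add: resolvent_hom)
    next
      case False
      then show ?thesis
        using Res[of m g] Res[of "- m" g]
        by (simp add: Res_eq_hom gen0_relations flip: resolvent_hom)
    qed
    then show ?case by (simp add: gen0.abs_eq)
  qed (simp_all add: resolvent_hom star_add star_mult star_scaleC star_star one mult sub
      flip: zero_resolvent_alg0_def one_resolvent_alg0_def plus_resolvent_alg0.abs_eq
        times_resolvent_alg0.abs_eq scaleC_resolvent_alg0.abs_eq star_resolvent_alg0.abs_eq)
  then have hom: "resolvent_hom a \<in> C" for a :: "'x resolvent_alg0"
    using Quotient3_abs_rep[OF Quotient3_resolvent_alg0] by metis
  then have embed: "completion_embed q \<in> C" for q :: "'x resolvent_quot"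
    using Quotient3_abs_rep[OF Quotient3_resolvent_quot] unfolding resolvent_hom_def by metis
  have "y \<in> closure C" for y
    unfolding closure_approachable using completion_dense embed
    by (metis dist_norm norm_minus_commute)
  then show ?thesis using \<open>closed C\<close> by auto
qed


section \<open>Decay of resolvents at the real axis\<close>

text \<open>
  The commutation relation passes from a resolvent \<open>R\<close> to \<open>D = x\<^sup>-\<^sup>1 R\<close>.  It will be used with
  \<open>G = R(\<mu>, g)\<close> and \<open>H = G\<^sup>2\<close>.
\<close>

lemma commutator_transfer:
  fixes R D G W x :: "'a::cstar_algebra"
  assumes W: "W * x = 1" "x * W = 1" and x: "x = 1 - c *\<^sub>C R"
    and D: "x * D = R" "D * x = R"
    and comm: "R * G - G * R = k *\<^sub>C (R * H * R)"
  shows "D * G - G * D = k *\<^sub>C (D * H * D)"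
proof -
  have "x * (D * G - G * D) * x = (x * D) * G * x - x * G * (D * x)"
    by (simp add: algebra_simps)
  also have "\<dots> = R * G - G * R"
    unfolding D by (simp add: x algebra_simps mult_scaleC_left mult_scaleC_right)
  also have "\<dots> = k *\<^sub>C ((x * D) * H * (D * x))"
    by (simp add: comm D)
  also have "\<dots> = x * (k *\<^sub>C (D * H * D)) * x"
    by (simp add: mult.assoc mult_scaleC_left mult_scaleC_right)
  finally have "W * (x * (D * G - G * D) * x) * W = W * (x * (k *\<^sub>C (D * H * D)) * x) * W"
    by simp
  then show ?thesis
    using W by (metis (no_types, lifting) mult.assoc mult.right_neutral mult_1)
qed

lemma norm_mult3_le: "norm (x * y * z) \<le> norm x * norm y * norm (z::'a::real_normed_algebra)"
  by (meson mult_right_mono norm_ge_zero norm_mult_ineq order_trans)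

text \<open>
  The sequence \<open>E\<close> stands for \<open>\<epsilon> D\<close>, where \<open>D\<close> is a resolvent at distance \<open>\<epsilon>\<close> from a point of the
  real axis, and \<open>S\<close> for the resolvents of an operator not commuting with the one underlying \<open>D\<close>.
  The hypotheses on \<open>star E\<close> and the commutators are those for \<open>D\<close>, rescaled.
\<close>

lemma resolvent_decay:
  fixes E :: "nat \<Rightarrow> 'a::cstar_algebra" and S :: "real \<Rightarrow> 'a" and \<epsilon> :: "nat \<Rightarrow> real"
  assumes S: "resolvent_family S" and s: "s \<noteq> 0" and k: "k \<noteq> 0" and \<epsilon>: "\<epsilon> \<longlonglongrightarrow> 0"
    and norm_E: "\<And>n. norm (E n) \<le> 1"
    and star_E: "\<And>n. star (E n) - E n = (2 * \<i>) *\<^sub>C (star (E n) * E n)"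
      "\<And>n. star (E n) - E n = (2 * \<i>) *\<^sub>C (E n * star (E n))"
    and comm: "\<And>n s. s \<noteq> 0 \<Longrightarrow>
      of_real (\<epsilon> n) *\<^sub>C (E n * S s - S s * E n) = k *\<^sub>C (E n * (S s * S s) * E n)"
  shows "(\<lambda>n. E n * S s) \<longlonglongrightarrow> 0" "(\<lambda>n. S s * E n) \<longlonglongrightarrow> 0"
proof -
  interpret resolvent_family S by fact
  define N where "N = {x. (\<lambda>n. E n * x * E n) \<longlonglongrightarrow> 0}"
  have bound: "norm (E n * x * E n) \<le> 1 * norm x" for n x
  proof -
    have "norm (E n * x * E n) \<le> norm (E n) * norm x * norm (E n)" by (rule norm_mult3_le)
    also have "\<dots> \<le> 1 * norm x * 1"
      using norm_E by (intro mult_mono) auto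
    finally show ?thesis by simp
  qed
  note * = null_set_closed_csubspace[of "\<lambda>n x. E n * x * E n", OF _ _ bound]
  have N: "closed N" "complex_vector.subspace N"
    unfolding N_def by (rule *; simp add: algebra_simps mult_scaleC_left mult_scaleC_right)+
  have "S r * S r \<in> N" if "r \<noteq> 0" for r
  proof -
    have eq: "E n * (S r * S r) * E n = (of_real (\<epsilon> n) / k) *\<^sub>C (E n * S r - S r * E n)" for n
    proof -
      have "(of_real (\<epsilon> n) / k) *\<^sub>C (E n * S r - S r * E n) =
          inverse k *\<^sub>C of_real (\<epsilon> n) *\<^sub>C (E n * S r - S r * E n)"
        by (simp add: scaleC_scaleC divide_inverse mult.commute)
      then show ?thesis
        using k by (simp only: comm[OF that]) (simp add: scaleC_scaleC scaleC_one)
    qed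
    have ES: "norm (E n * S r - S r * E n) \<le> 2 * norm (S r)" for n
    proof -
      have "norm (E n * S r - S r * E n) \<le> norm (E n) * norm (S r) + norm (S r) * norm (E n)"
        by (rule order_trans[OF norm_triangle_ineq4]) (intro add_mono norm_mult_ineq)
      also have "\<dots> \<le> 1 * norm (S r) + norm (S r) * 1"
        using norm_E by (intro add_mono mult_mono) auto
      finally show ?thesis by simp
    qed
    have "(\<lambda>n. \<bar>\<epsilon> n\<bar> / cmod k * (2 * norm (S r))) \<longlonglongrightarrow> 0"
      using \<epsilon> by (intro tendsto_mult_left_zero tendsto_divide_zero) (simp add: tendsto_rabs_zero_iff)
    then have "(\<lambda>n. E n * (S r * S r) * E n) \<longlonglongrightarrow> 0"
    proof (rule Lim_null_comparison[rotated], intro always_eventually allI)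
      show "norm (E n * (S r * S r) * E n) \<le> \<bar>\<epsilon> n\<bar> / cmod k * (2 * norm (S r))" for n
        unfolding eq norm_scaleC
        using ES[of n] by (simp add: norm_divide mult_left_mono divide_right_mono)
    qed
    then show ?thesis by (simp add: N_def)
  qed
  then have "closed_cspan {S r * S r | r. r \<noteq> 0} \<subseteq> N"
    by (intro closed_cspan_minimal N) auto
  then have SN: "S r \<in> N" if "r \<noteq> 0" for r
    using in_closed_cspan_squares[OF that] by blast
  \<comment> \<open>\<open>N\<close> is not an ideal, but \<open>S s * star (S s)\<close> is a linear combination of \<open>S s\<close> and \<open>S (- s)\<close>.\<close>
  have "inverse (2 * \<i> * of_real s) *\<^sub>C (star (S s) - S s) \<in> N"
    unfolding star_R[OF s] using s
    by (intro complex_vector.subspace_scale[OF N(2)] complex_vector.subspace_diff[OF N(2)] SN) simp_all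
  also have "inverse (2 * \<i> * of_real s) *\<^sub>C (star (S s) - S s) = S s * star (S s)"
  proof -
    have "2 * \<i> * complex_of_real s \<noteq> 0" using s by simp
    from left_inverse[OF this] show ?thesis
      unfolding star_mult_self(1)[OF s, symmetric] scaleC_scaleC by (simp only: scaleC_one)
  qed
  finally have lim: "(\<lambda>n. E n * (S s * star (S s)) * E n) \<longlonglongrightarrow> 0"
    by (simp add: N_def)
  have "(\<lambda>n. sqrt (norm (E n * (S s * star (S s)) * E n) * 3)) \<longlonglongrightarrow> sqrt 0"
    by (intro tendsto_real_sqrt tendsto_mult_left_zero tendsto_norm_zero lim)
  then have lim': "(\<lambda>n. sqrt (norm (E n * (S s * star (S s)) * E n) * 3)) \<longlonglongrightarrow> 0"
    by simp
  \<comment> \<open>\<open>E n\<close> and its adjoint differ by a bounded factor, so \<open>E n * T * E n\<close> controls \<open>E n * T * star (E n)\<close>.\<close>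
  define U where "U n = 1 + (2 * \<i>) *\<^sub>C star (E n)" for n
  have star_U: "star (E n) = U n * E n" "star (E n) = E n * U n" for n
    using star_E[of n] by (simp_all add: U_def algebra_simps mult_scaleC_left mult_scaleC_right)
  have norm_U: "norm (U n) \<le> 3" for n
    using norm_triangle_ineq[of 1 "(2 * \<i>) *\<^sub>C star (E n)"] norm_E[of n]
    by (simp add: U_def norm_scaleC norm_mult norm_star)
  have SS: "star (S s) * S s = S s * star (S s)"
    using commute[of s "- s"] s by (simp add: star_R)
  show "(\<lambda>n. E n * S s) \<longlonglongrightarrow> 0"
  proof (rule Lim_null_comparison[OF _ lim'], intro always_eventually allI)
    fix n
    have "(norm (E n * S s))\<^sup>2 = norm (E n * S s * star (E n * S s))"
      using cstar_identity[of "star (E n * S s)"] by (simp only: star_star norm_star)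
    also have "\<dots> = norm (E n * (S s * star (S s)) * E n * U n)"
      by (simp add: star_mult star_U(2) mult.assoc)
    also have "\<dots> \<le> norm (E n * (S s * star (S s)) * E n) * 3"
      by (rule order_trans[OF norm_mult_ineq mult_left_mono[OF norm_U norm_ge_zero]])
    finally show "norm (E n * S s) \<le> sqrt (norm (E n * (S s * star (S s)) * E n) * 3)"
      by (rule real_le_rsqrt)
  qed
  show "(\<lambda>n. S s * E n) \<longlonglongrightarrow> 0"
  proof (rule Lim_null_comparison[OF _ lim'], intro always_eventually allI)
    fix n
    have "(norm (S s * E n))\<^sup>2 = norm (U n * (E n * (star (S s) * S s) * E n))"
      unfolding cstar_identity[symmetric] star_mult by (simp add: star_U(1) mult.assoc)
    also have "\<dots> \<le> 3 * norm (E n * (S s * star (S s)) * E n)"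
      unfolding SS by (rule order_trans[OF norm_mult_ineq mult_right_mono[OF norm_U norm_ge_zero]])
    finally show "norm (S s * E n) \<le> sqrt (norm (E n * (S s * star (S s)) * E n) * 3)"
      by (intro real_le_rsqrt) (simp add: mult.commute)
  qed
qed


section \<open>Approximate units for the generators of the ideals\<close>

lemma asymptotically_central:
  fixes u :: "nat \<Rightarrow> 'x::symplectic_space resolvent_algebra"
  assumes u: "Bseq u" and Res: "\<And>m g. m \<noteq> 0 \<Longrightarrow> (\<lambda>n. u n * Res m g - Res m g * u n) \<longlonglongrightarrow> 0"
  shows "(\<lambda>n. u n * c - c * u n) \<longlonglongrightarrow> 0"
proof -
  obtain K where K: "\<And>n. norm (u n) \<le> K" using u unfolding Bseq_def by blast
  define C where "C = {c. (\<lambda>n. u n * c - c * u n) \<longlonglongrightarrow> 0}"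
  have bound: "norm (u n * c - c * u n) \<le> (2 * K) * norm c" for n c
  proof -
    have "norm (u n * c - c * u n) \<le> norm (u n) * norm c + norm c * norm (u n)"
      by (rule order_trans[OF norm_triangle_ineq4]) (intro add_mono norm_mult_ineq)
    also have "\<dots> \<le> K * norm c + norm c * K"
      using K by (intro add_mono mult_left_mono mult_right_mono) auto
    finally show ?thesis by (simp add: algebra_simps)
  qed
  note * = null_set_closed_csubspace[of "\<lambda>n c. u n * c - c * u n", OF _ _ bound]
  have "C = UNIV"
  proof (rule resolvent_algebra_generated)
    show "closed C" "complex_vector.subspace C"
      unfolding C_def by (rule *; simp add: algebra_simps mult_scaleC_left mult_scaleC_right)+
    show "1 \<in> C" by (simp add: C_def)
    show "Res m g \<in> C" if "m \<noteq> 0" for m g using Res[OF that] by (simp add: C_def)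
    fix a b assume "a \<in> C" "b \<in> C"
    then have "(\<lambda>n. (u n * a - a * u n) * b + a * (u n * b - b * u n)) \<longlonglongrightarrow> 0"
      by (intro tendsto_add_zero tendsto_mult_left_zero tendsto_mult_right_zero) (simp_all add: C_def)
    then show "a * b \<in> C" by (simp add: C_def algebra_simps)
  qed
  then show ?thesis by (auto simp: C_def)
qed

lemma quasicentral_unit_Res:
  fixes f :: "'x::symplectic_space"
  assumes l: "l \<noteq> 0"
  shows "quasicentral_unit (Res l f) (\<lambda>n. (\<i> * of_real (real (Suc n))) *\<^sub>C Res (real (Suc n)) f)"
proof -
  interpret resolvent_family "\<lambda>l. Res l f" by (rule resolvent_family_Res)
  define \<nu> where "\<nu> n = real (Suc n)" for n
  define u where "u n = (\<i> * of_real (\<nu> n)) *\<^sub>C Res (\<nu> n) f" for n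
  have \<nu>: "\<nu> n > 0" "\<nu> n \<noteq> 0" for n by (simp_all add: \<nu>_def)
  have lim: "(\<lambda>n. k * inverse (\<nu> n)) \<longlonglongrightarrow> 0" for k
    unfolding \<nu>_def by (intro tendsto_mult_right_zero LIMSEQ_inverse_real_of_nat)
  have R\<nu>: "norm (Res (\<nu> n) f) \<le> inverse (\<nu> n)" for n
    using norm_le[OF \<nu>(2)[of n]] \<nu>(1)[of n] by (simp add: divide_inverse)
  have norm_u: "norm (u n) \<le> 1" for n
    using R\<nu>[of n] \<nu>(1)[of n] by (simp add: u_def norm_scaleC norm_mult field_simps)
  have "\<exists>x. u n = Res l f * x \<and> u n = x * Res l f" for n
  proof (intro exI conjI)
    let ?y = "1 + (\<i> * of_real (l - \<nu> n)) *\<^sub>C Res (\<nu> n) f"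
    have "Res (\<nu> n) f = ?y * Res l f" "Res (\<nu> n) f = Res l f * ?y"
      using resolvent_eq[OF \<nu>(2) l, of n] commute[OF \<nu>(2) l, of n]
      by (simp_all add: algebra_simps mult_scaleC_left mult_scaleC_right)
    then show "u n = Res l f * ((\<i> * of_real (\<nu> n)) *\<^sub>C ?y)" "u n = (\<i> * of_real (\<nu> n)) *\<^sub>C ?y * Res l f"
      by (simp_all add: u_def mult_scaleC_left mult_scaleC_right)
  qed
  moreover have "Bseq u" using norm_u by (rule BseqI')
  moreover have "(\<lambda>n. u n * Res l f) \<longlonglongrightarrow> Res l f"
  proof (rule LIM_zero_cancel, rule Lim_null_comparison[OF _ lim[of 2]], intro always_eventually allI)
    fix n
    have "(\<i> * of_real l) *\<^sub>C (Res (\<nu> n) f * Res l f) - (\<i> * of_real (\<nu> n)) *\<^sub>C (Res (\<nu> n) f * Res l f)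
        = (\<i> * of_real (l - \<nu> n)) *\<^sub>C (Res (\<nu> n) f * Res l f)"
      by (simp add: complex_vector.scale_left_diff_distrib algebra_simps)
    also have "\<dots> = Res (\<nu> n) f - Res l f"
      using resolvent_eq[OF \<nu>(2) l, of n] by simp
    finally have "u n * Res l f - Res l f = (\<i> * of_real l) *\<^sub>C (Res (\<nu> n) f * Res l f) - Res (\<nu> n) f"
      by (simp add: u_def mult_scaleC_left algebra_simps)
    also have "norm \<dots> \<le> \<bar>l\<bar> * norm (Res (\<nu> n) f * Res l f) + norm (Res (\<nu> n) f)"
      by (rule order_trans[OF norm_triangle_ineq4]) (simp add: norm_scaleC norm_mult)
    also have "\<dots> \<le> \<bar>l\<bar> * (inverse (\<nu> n) * (1 / \<bar>l\<bar>)) + inverse (\<nu> n)"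
      using \<nu>(1)[of n]
      by (intro add_mono mult_left_mono order_trans[OF norm_mult_ineq] mult_mono R\<nu> norm_le l) auto
    also have "\<dots> = 2 * inverse (\<nu> n)" using l by simp
    finally show "norm (u n * Res l f - Res l f) \<le> 2 * inverse (\<nu> n)" .
  qed
  moreover have "(\<lambda>n. u n * c - c * u n) \<longlonglongrightarrow> 0" for c
  proof (rule asymptotically_central)
    fix m :: real and g :: 'x assume m: "m \<noteq> 0"
    let ?G = "Res m g"
    show "(\<lambda>n. u n * ?G - ?G * u n) \<longlonglongrightarrow> 0"
    proof (rule Lim_null_comparison[OF _ lim[of "\<bar>sform f g\<bar> * norm (?G * ?G)"]],
        intro always_eventually allI)
      fix n
      let ?R = "Res (\<nu> n) f"
      have "u n * ?G - ?G * u n = (\<i> * of_real (\<nu> n)) *\<^sub>C (?R * ?G - ?G * ?R)"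
        by (simp add: u_def mult_scaleC_left mult_scaleC_right complex_vector.scale_right_diff_distrib)
      also have "norm \<dots> = \<nu> n * \<bar>sform f g\<bar> * norm (?R * (?G * ?G) * ?R)"
        using \<nu>(1)[of n] unfolding Res_commutator[OF \<nu>(2) m]
        by (simp add: norm_scaleC norm_mult)
      also have "\<dots> \<le> \<nu> n * \<bar>sform f g\<bar> * (inverse (\<nu> n) * norm (?G * ?G) * inverse (\<nu> n))"
        using \<nu>(1)[of n]
        by (intro mult_left_mono order_trans[OF norm_mult3_le] mult_mono R\<nu>) auto
      also have "\<dots> = \<bar>sform f g\<bar> * norm (?G * ?G) * inverse (\<nu> n)"
        using \<nu>(1)[of n] by simp
      finally show "norm (u n * ?G - ?G * u n) \<le> \<bar>sform f g\<bar> * norm (?G * ?G) * inverse (\<nu> n)" .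
    qed
  qed (use \<open>Bseq u\<close> in simp)
  ultimately show ?thesis
    unfolding quasicentral_unit_def u_def \<nu>_def by blast
qed

text \<open>
  The only use of the spectrum: a nonzero spectral value is \<open>\<rho> = (il - t)\<^sup>-\<^sup>1\<close> with \<open>t\<close> real.
\<close>

lemma Im_eq_zero_of_spectrum:
  assumes l: "l \<noteq> 0" and \<rho>: "\<rho> \<noteq> 0" "\<rho> \<in> spectrum (Res l f)"
  shows "Im (\<i> * of_real l - 1 / \<rho>) = 0"
proof (rule ccontr)
  interpret resolvent_family "\<lambda>l. Res l f" by (rule resolvent_family_Res)
  define z where "z = - \<i> * (\<i> * of_real l - 1 / \<rho>)"
  assume "Im (\<i> * of_real l - 1 / \<rho>) \<noteq> 0"
  then have "Re z \<noteq> 0" by (simp add: z_def)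
  moreover have "\<i> * (of_real l - z) = 1 / \<rho>" by (simp add: z_def algebra_simps)
  ultimately obtain W where W: "W * (1 - (1 / \<rho>) *\<^sub>C Res l f) = 1" "(1 - (1 / \<rho>) *\<^sub>C Res l f) * W = 1"
    using inverse_exists[of z l] l by auto
  have "Res l f - \<rho> *\<^sub>C 1 = (- \<rho>) *\<^sub>C (1 - (1 / \<rho>) *\<^sub>C Res l f)"
    using \<rho>(1) by (simp add: complex_vector.scale_right_diff_distrib scaleC_scaleC scaleC_one)
  then have "((- (1 / \<rho>)) *\<^sub>C W) * (Res l f - \<rho> *\<^sub>C 1) = 1" "(Res l f - \<rho> *\<^sub>C 1) * ((- (1 / \<rho>)) *\<^sub>C W) = 1"
    using \<rho>(1) by (simp_all add: mult_scaleC_left mult_scaleC_right scaleC_scaleC W scaleC_one)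
  then show False using \<rho>(2) unfolding spectrum_def by blast
qed

lemma quasicentral_unit_Res_minus:
  fixes f :: "'x::symplectic_space"
  assumes l: "l \<noteq> 0" and \<rho>: "\<rho> \<noteq> 0" and t: "Im (\<i> * of_real l - 1 / \<rho>) = 0"
  shows "\<exists>u. quasicentral_unit (Res l f - \<rho> *\<^sub>C 1) u"
proof -
  interpret resolvent_family "\<lambda>l. Res l f" by (rule resolvent_family_Res)
  define \<epsilon> where "\<epsilon> n = inverse (real (Suc n))" for n
  have \<epsilon>: "\<epsilon> n > 0" for n by (simp add: \<epsilon>_def)
  have lim: "\<epsilon> \<longlonglongrightarrow> 0" unfolding \<epsilon>_def by (rule LIMSEQ_inverse_real_of_nat)
  \<comment> \<open>The spectral parameters \<open>i * z n = t + i * \<epsilon> n\<close> approach the real number \<open>t = il - 1 / \<rho>\<close>.\<close>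
  define z where "z n = of_real (\<epsilon> n) - \<i> * (\<i> * of_real l - 1 / \<rho>)" for n
  define c where "c n = \<i> * (of_real l - z n)" for n
  let ?R = "Res l f" and ?A = "Res l f - \<rho> *\<^sub>C 1"
  define x where "x n = 1 - c n *\<^sub>C ?R" for n
  have Re_z: "Re (z n) = \<epsilon> n" for n using t by (simp add: z_def)
  have c: "c n + \<i> * of_real (\<epsilon> n) = 1 / \<rho>" for n by (simp add: c_def z_def algebra_simps)
  have "\<exists>W D. W * x n = 1 \<and> x n * W = 1 \<and> x n * D = ?R \<and> D * x n = ?R \<and>
      (2 * \<i> * of_real (\<epsilon> n)) *\<^sub>C (star D * D) = star D - D \<and>
      (2 * \<i> * of_real (\<epsilon> n)) *\<^sub>C (D * star D) = star D - D \<and> norm D \<le> 1 / \<epsilon> n" for n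
    using complex_resolvent[of "z n" l] \<epsilon>[of n] l unfolding x_def c_def Re_z by (metis abs_of_pos less_irrefl)
  then obtain W D where W: "\<And>n. W n * x n = 1" "\<And>n. x n * W n = 1"
    and D: "\<And>n. x n * D n = ?R" "\<And>n. D n * x n = ?R"
    and star_D: "\<And>n. (2 * \<i> * of_real (\<epsilon> n)) *\<^sub>C (star (D n) * D n) = star (D n) - D n"
      "\<And>n. (2 * \<i> * of_real (\<epsilon> n)) *\<^sub>C (D n * star (D n)) = star (D n) - D n"
    and norm_D: "\<And>n. norm (D n) \<le> 1 / \<epsilon> n"
    by metis
  define E where "E n = complex_of_real (\<epsilon> n) *\<^sub>C D n" for n
  define u where "u n = 1 - \<i> *\<^sub>C E n" for n
  have norm_E: "norm (E n) \<le> 1" for n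
    using norm_D[of n] \<epsilon>[of n] by (simp add: E_def norm_scaleC field_simps)
  have star_E: "star (E n) - E n = (2 * \<i>) *\<^sub>C (star (E n) * E n)"
    "star (E n) - E n = (2 * \<i>) *\<^sub>C (E n * star (E n))" for n
  proof -
    have "star (E n) - E n = of_real (\<epsilon> n) *\<^sub>C (star (D n) - D n)"
      by (simp add: E_def star_scaleC complex_vector.scale_right_diff_distrib)
    then show "star (E n) - E n = (2 * \<i>) *\<^sub>C (star (E n) * E n)"
      "star (E n) - E n = (2 * \<i>) *\<^sub>C (E n * star (E n))"
      by (simp only: star_D(1)[symmetric], simp add: E_def star_scaleC mult_scaleC_left mult_scaleC_right scaleC_scaleC mult_ac,
          simp only: star_D(2)[symmetric], simp add: E_def star_scaleC mult_scaleC_left mult_scaleC_right scaleC_scaleC mult_ac)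
  qed
  have comm: "D n * Res m g - Res m g * D n =
      (\<i> * of_real (sform f g)) *\<^sub>C (D n * (Res m g * Res m g) * D n)" if "m \<noteq> 0" for n m g
    by (rule commutator_transfer[OF W x_def D Res_commutator[OF l that]])
  \<comment> \<open>Since \<open>x n\<close> has the inverse \<open>W n\<close>, this makes \<open>u n\<close> a multiple of \<open>?A\<close> on both sides.\<close>
  have u: "u n * x n = (- (1 / \<rho>)) *\<^sub>C ?A" "x n * u n = (- (1 / \<rho>)) *\<^sub>C ?A" for n
  proof -
    have "1 - c n *\<^sub>C ?R - (\<i> * of_real (\<epsilon> n)) *\<^sub>C ?R = 1 - (1 / \<rho>) *\<^sub>C ?R"
      unfolding c[of n, symmetric] scaleC_add_left by simp
    also have "\<dots> = (- (1 / \<rho>)) *\<^sub>C ?A"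
      using \<rho> by (simp add: complex_vector.scale_right_diff_distrib scaleC_scaleC scaleC_one)
    finally have *: "x n - (\<i> * of_real (\<epsilon> n)) *\<^sub>C ?R = (- (1 / \<rho>)) *\<^sub>C ?A"
      by (simp add: x_def)
    show "u n * x n = (- (1 / \<rho>)) *\<^sub>C ?A" "x n * u n = (- (1 / \<rho>)) *\<^sub>C ?A"
      unfolding *[symmetric] by (simp_all add: u_def E_def scaleC_scaleC left_diff_distrib
          right_diff_distrib mult_scaleC_left mult_scaleC_right D)
  qed
  have norm_u: "norm (u n) \<le> 2" for n
    using norm_triangle_ineq4[of 1 "\<i> *\<^sub>C E n"] norm_E[of n] by (simp add: u_def norm_scaleC)
  have "\<exists>y. u n = ?A * y \<and> u n = y * ?A" for n
  proof (intro exI conjI)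
    have "u n = u n * x n * W n" "u n = W n * (x n * u n)"
      using W by (simp_all add: mult.assoc) (simp flip: mult.assoc)
    then show "u n = ?A * ((- (1 / \<rho>)) *\<^sub>C W n)" "u n = ((- (1 / \<rho>)) *\<^sub>C W n) * ?A"
      unfolding u by (simp_all only: mult_scaleC_left mult_scaleC_right)
  qed
  moreover have "Bseq u" using norm_u by (rule BseqI')
  moreover have "(\<lambda>n. u n * ?A) \<longlonglongrightarrow> ?A"
  proof (rule LIM_zero_cancel, rule Lim_null_comparison, intro always_eventually allI)
    show "(\<lambda>n. \<epsilon> n * (cmod \<rho> * (2 * norm ?R))) \<longlonglongrightarrow> 0"
      by (intro tendsto_mult_left_zero lim)
    fix n
    have "?A = (- \<rho>) *\<^sub>C (u n * x n)"
      using \<rho> by (simp add: u scaleC_scaleC scaleC_one)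
    then have "E n * ?A = (- \<rho>) *\<^sub>C (E n * u n * x n)"
      by (simp only: mult_scaleC_right mult.assoc)
    also have "E n * u n = u n * E n"
      by (simp add: u_def algebra_simps mult_scaleC_left mult_scaleC_right)
    also have "u n * E n * x n = of_real (\<epsilon> n) *\<^sub>C (u n * ?R)"
      by (simp add: E_def mult_scaleC_left mult_scaleC_right mult.assoc D)
    finally have EA: "norm (E n * ?A) = cmod \<rho> * (\<epsilon> n * norm (u n * ?R))"
      using \<epsilon>[of n] by (simp add: norm_scaleC norm_mult)
    have "u n * ?A - ?A = - (\<i> *\<^sub>C (E n * ?A))"
      by (simp add: u_def left_diff_distrib mult_scaleC_left)
    then have "norm (u n * ?A - ?A) = cmod \<rho> * (\<epsilon> n * norm (u n * ?R))"
      by (simp add: norm_scaleC EA)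
    also have "\<dots> \<le> cmod \<rho> * (\<epsilon> n * (2 * norm ?R))"
      using \<epsilon>[of n] norm_u
      by (intro mult_left_mono order_trans[OF norm_mult_ineq] mult_right_mono) auto
    finally show "norm (u n * ?A - ?A) \<le> \<epsilon> n * (cmod \<rho> * (2 * norm ?R))"
      by (simp add: mult_ac)
  qed
  moreover have "(\<lambda>n. u n * b - b * u n) \<longlonglongrightarrow> 0" for b
  proof (rule asymptotically_central[OF \<open>Bseq u\<close>])
    fix m :: real and g :: 'x assume m: "m \<noteq> 0"
    let ?G = "Res m g"
    have "(\<lambda>n. E n * ?G - ?G * E n) \<longlonglongrightarrow> 0"
    proof (cases "sform f g = 0")
      case True
      then have "E n * ?G - ?G * E n = 0" for n
        using comm[OF m, of n g]
        by (simp add: E_def mult_scaleC_left mult_scaleC_right)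
      then show ?thesis by simp
    next
      case False
      then have k: "\<i> * of_real (sform f g) \<noteq> 0" by simp
      have comm_E: "of_real (\<epsilon> n) *\<^sub>C (E n * Res s g - Res s g * E n) =
          (\<i> * of_real (sform f g)) *\<^sub>C (E n * (Res s g * Res s g) * E n)" if "s \<noteq> 0" for n s
      proof -
        have "of_real (\<epsilon> n) *\<^sub>C (E n * Res s g - Res s g * E n) =
            of_real ((\<epsilon> n)\<^sup>2) *\<^sub>C (D n * Res s g - Res s g * D n)"
          by (simp add: E_def mult_scaleC_left mult_scaleC_right scaleC_scaleC power2_eq_square
              complex_vector.scale_right_diff_distrib)
        then show ?thesis
          unfolding comm[OF that]
          by (simp add: E_def mult_scaleC_left mult_scaleC_right scaleC_scaleC power2_eq_square mult_ac)
      qed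
      have "(\<lambda>n. E n * ?G) \<longlonglongrightarrow> 0" "(\<lambda>n. ?G * E n) \<longlonglongrightarrow> 0"
        using resolvent_decay[OF resolvent_family_Res m k lim norm_E star_E comm_E] by blast+
      from tendsto_diff[OF this] show ?thesis by simp
    qed
    from bounded_linear.tendsto_zero[OF bounded_linear_scaleC this, of "- \<i>"]
    show "(\<lambda>n. u n * ?G - ?G * u n) \<longlonglongrightarrow> 0"
      by (simp add: u_def algebra_simps mult_scaleC_left mult_scaleC_right)
  qed
  ultimately show ?thesis
    unfolding quasicentral_unit_def by blast
qed

lemma quasicentral_unit_exists:
  assumes "l \<noteq> 0" "\<rho> \<in> spectrum (Res l f)"
  shows "\<exists>u. quasicentral_unit (Res l f - \<rho> *\<^sub>C 1) u"
proof (cases "\<rho> = 0")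
  case True
  then show ?thesis using quasicentral_unit_Res[OF assms(1), of f] by auto
next
  case False
  then show ?thesis
    using quasicentral_unit_Res_minus Im_eq_zero_of_spectrum assms by blast
qed


section \<open>Intersections of ideals\<close>

theorem proposition4p4:
  fixes f :: "nat \<Rightarrow> 'x::symplectic_space"
    and l :: "nat \<Rightarrow> real"
    and \<rho> :: "nat \<Rightarrow> complex"
    and p :: "nat \<Rightarrow> nat"
    and n :: nat
  assumes "n \<ge> 1"
    and "\<And>m. m \<in> {1..n} \<Longrightarrow> f m \<noteq> 0"
    and "\<And>m. m \<in> {1..n} \<Longrightarrow> l m \<noteq> 0"
    and "\<And>m. m \<in> {1..n} \<Longrightarrow> \<rho> m \<in> spectrum (Res (l m) (f m))"
    and "p permutes {1..n}"
  shows "let I = (\<Inter>m\<in>{1..n}. ideal_generated {Res (l m) (f m) - \<rho> m *\<^sub>C 1});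
             P = (\<Prod>m\<leftarrow>map p [1..<Suc n]. Res (l m) (f m) - \<rho> m *\<^sub>C 1)
         in I = closed_cspan {a * P * b | a b. True}
            \<and> I = closed_cspan {P * b | b. True}
            \<and> I = closed_cspan {a * P | a. True}"
proof -
  have set_p: "set (map p [1..<Suc n]) = {1..n}"
    using permutes_image[OF assms(5)] by (simp add: atLeastLessThanSuc_atLeastAtMost del: upt_Suc)
  have "\<exists>u. quasicentral_unit (Res (l m) (f m) - \<rho> m *\<^sub>C 1) u" if "m \<in> set (map p [1..<Suc n])" for m
    using that quasicentral_unit_exists assms(3,4) unfolding set_p by blast
  from Inter_ideals_eq_product[of "map p [1..<Suc n]" "\<lambda>m. Res (l m) (f m) - \<rho> m *\<^sub>C 1", OF this]
  show ?thesis
    unfolding Let_def set_p by (intro conjI)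
qed

end
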